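(* Let $\Gamma\colon SU(3)\to SU(3)$ be the map $\Gamma(A)=A\,\overline A$. The image $\Gamma(SU(3))$ is the hypersurface $$\mathcal H=\{B\in SU(3):\operatorname{Tr}B\in\mathbb R\},$$ and $\mathcal H$ is homeomorphic to the Thom space of the vector bundle $\Lambda^2_-\mathbb{CP}^2$. The restriction of $\Gamma$ to $SU(3)\setminus\mathbb L$ is a principal $S^1$-bundle over $\Lambda^2_-\mathbb{CP}^2$, where $\Lambda^2_-\mathbb{CP}^2$ is identified with $\mathcal H\setminus\{I\}$ (the complement of the Thom point).
   Context: $\overline A$ is the complex conjugate matrix and $I$ the identity matrix. $\mathbb L\cong SU(3)/SO(3)$ denotes the orbit of $I$ under the consimilarity action $A\cdot B=AB\overline A^{-1}=ABA^t$ of $SU(3)$ on itself, i.e. $\mathbb L=\{AA^t:A\in SU(3)\}\subset SU(3)$. $\Lambda^2_-\mathbb{CP}^2$ is the total space of the rank $3$ real vector bundle of anti-self-dual $2$-forms on $\mathbb{CP}^2=SU(3)/S(U(2)\times U(1))$; equivalently it is the homogeneous bundle $SU(3)\times_{U(2)}\mathfrak{su}(2)$, where $U(2)=S(U(2)\times U(1))$ acts on $\mathfrak{su}(2)$ by the adjoint action. The Thom space of a vector bundle over a compact base is the one-point compactification of its total space; the added point is the Thom point. "Hypersurface" allows a singular point. *)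

theory Defs
  imports "HOL-Analysis.Analysis"
begin

section \<open>The group $SU(n)$, the map $\Gamma$ and the sets $\mathbb{L}$, $\mathcal{H}$\<close>

definition conj_mat :: "complex^'n^'m \<Rightarrow> complex^'n^'m" where
  "conj_mat A = map_matrix cnj A"

definition SU :: "(complex^'n^'n) set" where
  "SU = {A. A ** transpose (conj_mat A) = mat 1 \<and> det A = 1}"

abbreviation SU3 :: "(complex^3^3) set" where
  "SU3 \<equiv> SU"

definition Gamma_map :: "complex^3^3 \<Rightarrow> complex^3^3" where
  "Gamma_map A = A ** conj_mat A"

definition LL :: "(complex^3^3) set" where
  "LL = {A ** transpose A | A. A \<in> SU3}"

definition HH :: "(complex^3^3) set" where
  "HH = {B \<in> SU3. trace B \<in> \<real>}"


section \<open>Hypersurfaces of a subset of Euclidean space\<close>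

text \<open>
  \<open>C_k_on k f U\<close> is only meant for open \<open>U\<close>: there the derivative \<open>f'\<close> is unique, and since the
  domain is finite-dimensional it is enough to differentiate the directional derivatives
  \<open>\<lambda>x. f' x v\<close> further.
\<close>

primrec C_k_on :: "nat \<Rightarrow> ('a::euclidean_space \<Rightarrow> real) \<Rightarrow> 'a set \<Rightarrow> bool" where
  "C_k_on 0 f U \<longleftrightarrow> continuous_on U f"
| "C_k_on (Suc k) f U \<longleftrightarrow>
     (\<exists>f'. (\<forall>x\<in>U. (f has_derivative f' x) (at x)) \<and> (\<forall>v. C_k_on k (\<lambda>x. f' x v) U))"

definition smooth_on :: "('a::euclidean_space \<Rightarrow> real) \<Rightarrow> 'a set \<Rightarrow> bool" where
  "smooth_on f U \<longleftrightarrow> (\<forall>k. C_k_on k f U)"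

text \<open>
  Velocities at \<open>p\<close> of curves in \<open>M\<close>; for a smooth submanifold \<open>M\<close> (the only case of interest)
  this is the tangent space of \<open>M\<close> at \<open>p\<close>.
\<close>

definition tangent_vectors :: "'a::euclidean_space set \<Rightarrow> 'a \<Rightarrow> 'a set" where
  "tangent_vectors M p =
     {v. \<exists>\<gamma>::real \<Rightarrow> 'a. (\<forall>t. \<gamma> t \<in> M) \<and> \<gamma> 0 = p \<and> (\<gamma> has_vector_derivative v) (at 0)}"

text \<open>
  Near \<open>p\<close>, the set \<open>H\<close> is the zero set in \<open>M\<close> of a smooth function whose differential at \<open>p\<close> does
  not vanish on the tangent space of \<open>M\<close>, i.e. a submanifold of \<open>M\<close> of codimension one.
\<close>

definition smooth_hypersurface_at :: "'a::euclidean_space set \<Rightarrow> 'a set \<Rightarrow> 'a \<Rightarrow> bool" where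
  "smooth_hypersurface_at M H p \<longleftrightarrow>
     (\<exists>U f. open U \<and> p \<in> U \<and> smooth_on f U \<and> H \<inter> U = {x \<in> M \<inter> U. f x = 0} \<and>
            (\<exists>v \<in> tangent_vectors M p. frechet_derivative f (at p) v \<noteq> 0))"

definition hypersurface_with_singularities ::
    "'a::euclidean_space set \<Rightarrow> 'a set \<Rightarrow> 'a set \<Rightarrow> bool" where
  "hypersurface_with_singularities M H S \<longleftrightarrow>
     closedin (top_of_set M) H \<and> (\<forall>p \<in> H - S. smooth_hypersurface_at M H p)"


section \<open>The total space of $\Lambda^2_-\mathbb{CP}^2 = SU(3)\times_{U(2)}\mathfrak{su}(2)$\<close>

definition quotient_topology :: "'a topology \<Rightarrow> ('a \<Rightarrow> 'b) \<Rightarrow> 'b topology" where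
  "quotient_topology X f =
     topology (\<lambda>U. U \<subseteq> f ` topspace X \<and> openin X {x \<in> topspace X. f x \<in> U})"

lemma openin_quotient_topology:
  "openin (quotient_topology X f) U \<longleftrightarrow>
     U \<subseteq> f ` topspace X \<and> openin X {x \<in> topspace X. f x \<in> U}"
proof -
  have "istopology (\<lambda>U. U \<subseteq> f ` topspace X \<and> openin X {x \<in> topspace X. f x \<in> U})"
    unfolding istopology_def
  proof (intro conjI allI impI)
    fix S T
    assume S: "S \<subseteq> f ` topspace X \<and> openin X {x \<in> topspace X. f x \<in> S}"
      and T: "T \<subseteq> f ` topspace X \<and> openin X {x \<in> topspace X. f x \<in> T}"
    show "S \<inter> T \<subseteq> f ` topspace X" using S by blast
    have "{x \<in> topspace X. f x \<in> S \<inter> T}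
        = {x \<in> topspace X. f x \<in> S} \<inter> {x \<in> topspace X. f x \<in> T}" by blast
    then show "openin X {x \<in> topspace X. f x \<in> S \<inter> T}" using S T by (simp add: openin_Int)
  next
    fix K
    assume K: "\<forall>U\<in>K. U \<subseteq> f ` topspace X \<and> openin X {x \<in> topspace X. f x \<in> U}"
    show "\<Union>K \<subseteq> f ` topspace X" using K by blast
    have eq: "{x \<in> topspace X. f x \<in> \<Union>K} = (\<Union>U\<in>K. {x \<in> topspace X. f x \<in> U})" by blast
    show "openin X {x \<in> topspace X. f x \<in> \<Union>K}"
      unfolding eq by (rule openin_Union) (use K in auto)
  qed
  then show ?thesis by (simp add: quotient_topology_def)
qed

lemma topspace_quotient_topology [simp]:
  "topspace (quotient_topology X f) = f ` topspace X"
proof -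
  have "{x \<in> topspace X. f x \<in> f ` topspace X} = topspace X" by blast
  then have "openin (quotient_topology X f) (f ` topspace X)"
    by (simp add: openin_quotient_topology)
  then show ?thesis
    by (metis openin_quotient_topology openin_subset openin_topspace subset_antisym)
qed

lemma quotient_map_quotient_topology: "quotient_map X (quotient_topology X f) f"
  by (auto simp: quotient_map_def openin_quotient_topology)

text \<open>The subgroup $S(U(2)\times U(1))$ of block diagonal matrices.\<close>

definition S_U2_U1 :: "(complex^3^3) set" where
  "S_U2_U1 = {h \<in> SU3. h$1$3 = 0 \<and> h$2$3 = 0 \<and> h$3$1 = 0 \<and> h$3$2 = 0}"

text \<open>
  $\mathfrak{su}(2)$ sits in the upper left block of $\mathfrak{su}(3)$. It is an ideal of the Lie
  algebra of \<open>S_U2_U1\<close>, on which \<open>S_U2_U1\<close> acts by conjugation.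
\<close>

definition su2 :: "(complex^3^3) set" where
  "su2 = {X. transpose (conj_mat X) = - X \<and> trace X = 0 \<and> (\<forall>i. X$i$3 = 0 \<and> X$3$i = 0)}"

text \<open>The class $[g,X]$, where $(g,X)\sim(gh,\mathrm{Ad}(h^{-1})X)$.\<close>

definition assoc_class :: "(complex^3^3) \<times> (complex^3^3) \<Rightarrow> ((complex^3^3) \<times> (complex^3^3)) set" where
  "assoc_class = (\<lambda>(g, X). {(g ** h, matrix_inv h ** X ** h) | h. h \<in> S_U2_U1})"

definition Lambda2_minus_CP2 :: "((complex^3^3) \<times> (complex^3^3)) set topology" where
  "Lambda2_minus_CP2 = quotient_topology (top_of_set (SU3 \<times> su2)) assoc_class"


section \<open>Principal circle bundles\<close>

abbreviation circle :: "complex topology" where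
  "circle \<equiv> top_of_set (sphere 0 1)"

text \<open>
  Freeness of the action and transitivity on the fibres of \<open>p\<close> follow from the equivariance of the
  local trivialisations \<open>\<phi>\<close>.
\<close>

definition principal_circle_bundle :: "'a topology \<Rightarrow> 'b topology \<Rightarrow> ('a \<Rightarrow> 'b) \<Rightarrow> bool" where
  "principal_circle_bundle E B p \<longleftrightarrow>
     continuous_map E B p \<and>
     (\<exists>act :: 'a \<Rightarrow> complex \<Rightarrow> 'a.
        continuous_map (prod_topology E circle) E (\<lambda>(x, z). act x z) \<and>
        (\<forall>x \<in> topspace E. act x 1 = x) \<and>
        (\<forall>x \<in> topspace E. \<forall>z \<in> sphere 0 1. \<forall>w \<in> sphere 0 1. act (act x z) w = act x (z * w)) \<and>
        (\<forall>b \<in> topspace B. \<exists>U \<phi>. openin B U \<and> b \<in> U \<and>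
           homeomorphic_map (prod_topology (subtopology B U) circle)
             (subtopology E {x \<in> topspace E. p x \<in> U}) \<phi> \<and>
           (\<forall>u \<in> U. \<forall>z \<in> sphere 0 1. p (\<phi> (u, z)) = u) \<and>
           (\<forall>u \<in> U. \<forall>z \<in> sphere 0 1. \<forall>w \<in> sphere 0 1. \<phi> (u, z * w) = act (\<phi> (u, z)) w)))"

end

theory Submission
  imports Defs
begin

text \<open>
  For \<open>B \<in> HH\<close> with \<open>B \<noteq> mat 1\<close> the eigenvalues are $1, e^{i\theta}, e^{-i\theta}$ with
  $e^{i\theta} \neq 1$, so that $B = g\,(b \oplus 1)\,g^*$ with \<open>g \<in> SU3\<close> and $1 \neq b \in SU(2)$. The
  Cayley transform $X \mapsto -(1+X)(1-X)^{-1}$ identifies $\mathfrak{su}(2)$ equivariantly with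
  $SU(2) \setminus \{1\}$, which turns $\mathcal{H} \setminus \{I\}$ into $SU(3)\times_{U(2)}\mathfrak{su}(2)$.

  If $A\overline{A} = B$, then $B A^t = A$. In the frame $g$ this linear equation determines the
  upper left block of $A$ up to a scalar $z$, which unitarity puts on the unit circle, and
  $\det A = 1$ forces the remaining entry to be $z^{-2}$. So the circle acts on the fibre of $\Gamma$ over
  $B$ by $z Q + z^{-2} (1 - Q)$ from the left, where $Q$ is the orthogonal projection onto the plane of
  the eigenvalues $e^{\pm i\theta}$.
\<close>

section \<open>Hermitian transposes and $SU(3)$\<close>

text \<open>The minus sign in the Cayley transform sends the zero section to b = -1 and infinity to
  b = 1, which makes I the Thom point.

  Two things are not visible in the pointwise normal form. The quotient topology must agree with the
  subspace topology of \<open>HH\<close>: the trace of the image of [g, X] is 3 - 4/(1 + r^2) with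
  r^2 = det X, so staying away from I bounds X, and the parametrisation \<open>Psi\<close> is a
  closed map. And local triviality needs a lift of B that is continuous in B, while an eigenframe of
  B degenerates where the two eigenvalues on the plane coincide, at theta = pi. The way out is that
  the lift with parameter z = 1 depends on the frame only through its last column, a unit vector
  fixed by B. Projecting a constant vector onto the fixed line produces such a column continuously,
  wherever the projection does not vanish. The remaining columns may then be chosen separately for
  each B, without any continuity.\<close>

definition adj :: "complex^'n^'m \<Rightarrow> complex^'m^'n" where
  "adj A = transpose (conj_mat A)"

definition smul :: "complex \<Rightarrow> complex^'n^'m \<Rightarrow> complex^'n^'m" where
  "smul z A = (\<chi> i j. z * A$i$j)"

lemma conj_mat_nth [simp]: "conj_mat A $ i $ j = cnj (A $ i $ j)"
  by (simp add: conj_mat_def)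

lemma transpose_nth [simp]: "transpose A $ i $ j = A $ j $ i"
  by (simp add: transpose_def)

lemma adj_nth [simp]: "adj A $ i $ j = cnj (A $ j $ i)"
  by (simp add: adj_def)

lemma smul_nth [simp]: "smul z A $ i $ j = z * A $ i $ j"
  by (simp add: smul_def)

lemma mat3_eq_iff:
  "A = B \<longleftrightarrow> A$1$1 = B$1$1 \<and> A$1$2 = B$1$2 \<and> A$1$3 = B$1$3 \<and>
     A$2$1 = B$2$1 \<and> A$2$2 = B$2$2 \<and> A$2$3 = B$2$3 \<and>
     A$3$1 = B$3$1 \<and> A$3$2 = B$3$2 \<and> A$3$3 = B$3$3" for A B :: "'a^3^3"
  by (simp add: vec_eq_iff forall_3)

lemma mm_nth: "(A ** B) $ i $ j = A$i$1 * B$1$j + A$i$2 * B$2$j + A$i$3 * B$3$j"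
  for A :: "'a::semiring_1^3^'n"
  by (simp add: matrix_matrix_mult_def sum_3)

lemma mat_nth: "mat k $ i $ j = (if i = j then k else 0)"
  by (simp add: mat_def)

lemma smul_mult_left: "smul z A ** B = smul z (A ** B)"
  by (simp add: vec_eq_iff matrix_matrix_mult_def sum_distrib_left mult.assoc)

lemma smul_mult_right: "A ** smul z B = smul z (A ** B)"
  by (simp add: vec_eq_iff matrix_matrix_mult_def sum_distrib_left algebra_simps)

lemma smul_smul [simp]: "smul z (smul w A) = smul (z * w) A"
  by (simp add: vec_eq_iff mult.assoc)

lemma smul_one [simp]: "smul 1 A = A"
  by (simp add: vec_eq_iff)

lemma smul_add: "smul z (A + B) = smul z A + smul z B"
  by (simp add: vec_eq_iff algebra_simps)

lemma mm_diff_left: "(A - B) ** C = A ** C - B ** C" for A :: "'a::ring_1^'n^'m"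
  by (simp add: vec_eq_iff matrix_matrix_mult_def sum_subtractf algebra_simps)

lemma mm_diff_right: "A ** (B - C) = A ** B - A ** C" for A :: "'a::ring_1^'n^'m"
  by (simp add: vec_eq_iff matrix_matrix_mult_def sum_subtractf algebra_simps)

lemma mm_add_left: "(A + B) ** C = A ** C + B ** C" for A :: "'a::semiring_1^'n^'m"
  by (simp add: vec_eq_iff matrix_matrix_mult_def sum.distrib algebra_simps)

lemma adj_mult: "adj (A ** B) = adj B ** adj A"
  by (simp add: vec_eq_iff matrix_matrix_mult_def mult.commute)

lemma conj_mat_mult: "conj_mat (A ** B) = conj_mat A ** conj_mat B"
  by (simp add: vec_eq_iff matrix_matrix_mult_def)

lemma adj_adj [simp]: "adj (adj A) = A"
  by (simp add: vec_eq_iff)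

lemma adj_add: "adj (A + B) = adj A + adj B"
  and adj_diff: "adj (A - B) = adj A - adj B"
  and adj_smul: "adj (smul z A) = smul (cnj z) (adj A)"
  and adj_mat: "adj (mat k) = mat (cnj k)"
  by (simp_all add: vec_eq_iff mat_def)

lemma conj_mat_conj_mat [simp]: "conj_mat (conj_mat A) = A"
  and conj_mat_transpose: "conj_mat (transpose A) = adj A"
  and conj_mat_adj: "conj_mat (adj A) = transpose A"
  and adj_transpose: "adj (transpose A) = conj_mat A"
  and adj_conj_mat: "adj (conj_mat A) = transpose A"
  and transpose_adj: "transpose (adj A) = conj_mat A"
  and conj_mat_mat: "conj_mat (mat k) = mat (cnj k)"
  by (simp_all add: vec_eq_iff mat_def)

lemma SU_iff: "A \<in> SU \<longleftrightarrow> A ** adj A = mat 1 \<and> det A = 1"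
  by (simp add: SU_def adj_def)

lemma SU_right: "A \<in> SU \<Longrightarrow> A ** adj A = mat 1"
  by (simp add: SU_iff)

lemma SU_left: "A \<in> SU \<Longrightarrow> adj A ** A = mat 1"
  using SU_iff matrix_left_right_inverse by blast

lemma SU_det: "A \<in> SU \<Longrightarrow> det A = 1"
  by (simp add: SU_iff)

lemma mult_adj_cancel: "A \<in> SU \<Longrightarrow> B ** A ** adj A = B"
  and mult_adj_cancel': "A \<in> SU \<Longrightarrow> B ** adj A ** A = B"
  by (simp_all add: SU_left SU_right flip: matrix_mul_assoc)

lemma det_conj_mat: "det (conj_mat A) = cnj (det A)"
  by (simp add: det_def sign_def)

lemma SU_mult: "A \<in> SU \<Longrightarrow> B \<in> SU \<Longrightarrow> A ** B \<in> SU"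
  unfolding SU_iff
  by (metis adj_mult det_mul matrix_mul_assoc matrix_mul_rid mult_1)

lemma SU_adj: "A \<in> SU \<Longrightarrow> adj A \<in> SU"
  by (metis SU_iff SU_left adj_adj adj_def det_conj_mat det_transpose complex_cnj_one)

lemma SU_transpose: "A \<in> SU \<Longrightarrow> transpose A \<in> SU"
  unfolding SU_iff
  by (metis SU_iff SU_left adj_transpose complex_cnj_one conj_mat_adj conj_mat_mat conj_mat_mult det_transpose)

lemma SU_conj_mat: "A \<in> SU \<Longrightarrow> conj_mat A \<in> SU"
  by (metis SU_adj SU_transpose transpose_adj)

lemma SU_one: "mat 1 \<in> SU"
  by (simp add: SU_iff adj_mat)

lemma SU_matrix_inv:
  assumes "A \<in> SU"
  shows "matrix_inv A = adj A"
proof -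
  have "A ** matrix_inv A = mat 1 \<and> matrix_inv A ** A = mat 1"
    unfolding matrix_inv_def by (rule someI[of _ "adj A"]) (use assms in \<open>simp add: SU_left SU_right\<close>)
  then show ?thesis
    by (metis SU_left assms matrix_mul_assoc matrix_mul_lid matrix_mul_rid)
qed

lemma SU_cancel_left: "A \<in> SU \<Longrightarrow> A ** B = A ** C \<longleftrightarrow> B = C"
  by (metis SU_left matrix_mul_assoc matrix_mul_lid)

text \<open>\<open>M\<close> is the adjugate of \<open>A\<close>; as det A = 1, it is the inverse,
  hence equal to \<open>adj A\<close>. Comparing entries identifies each conjugated entry with a
  cofactor.\<close>

lemma SU3_minors:
  assumes "A \<in> SU3"
  shows "cnj (A$1$1) = A$2$2 * A$3$3 - A$2$3 * A$3$2"
    "cnj (A$1$2) = A$2$3 * A$3$1 - A$2$1 * A$3$3"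
    "cnj (A$1$3) = A$2$1 * A$3$2 - A$2$2 * A$3$1"
    "cnj (A$2$1) = A$1$3 * A$3$2 - A$1$2 * A$3$3"
    "cnj (A$2$2) = A$1$1 * A$3$3 - A$1$3 * A$3$1"
    "cnj (A$2$3) = A$1$2 * A$3$1 - A$1$1 * A$3$2"
    "cnj (A$3$1) = A$1$2 * A$2$3 - A$1$3 * A$2$2"
    "cnj (A$3$2) = A$1$3 * A$2$1 - A$1$1 * A$2$3"
    "cnj (A$3$3) = A$1$1 * A$2$2 - A$1$2 * A$2$1"
proof -
  define M :: "complex^3^3" where "M = vector
    [vector [A$2$2 * A$3$3 - A$2$3 * A$3$2, A$1$3 * A$3$2 - A$1$2 * A$3$3, A$1$2 * A$2$3 - A$1$3 * A$2$2],
     vector [A$2$3 * A$3$1 - A$2$1 * A$3$3, A$1$1 * A$3$3 - A$1$3 * A$3$1, A$1$3 * A$2$1 - A$1$1 * A$2$3],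
     vector [A$2$1 * A$3$2 - A$2$2 * A$3$1, A$1$2 * A$3$1 - A$1$1 * A$3$2, A$1$1 * A$2$2 - A$1$2 * A$2$1]]"
  have "A ** M = mat (det A)"
    by (simp add: mat3_eq_iff mm_nth mat_nth M_def det_3 algebra_simps)
  then have "A ** M = A ** adj A"
    using assms by (simp add: SU_iff)
  then have "adj A = M"
    using assms SU_cancel_left by metis
  then show "cnj (A$1$1) = A$2$2 * A$3$3 - A$2$3 * A$3$2"
    "cnj (A$1$2) = A$2$3 * A$3$1 - A$2$1 * A$3$3"
    "cnj (A$1$3) = A$2$1 * A$3$2 - A$2$2 * A$3$1"
    "cnj (A$2$1) = A$1$3 * A$3$2 - A$1$2 * A$3$3"
    "cnj (A$2$2) = A$1$1 * A$3$3 - A$1$3 * A$3$1"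
    "cnj (A$2$3) = A$1$2 * A$3$1 - A$1$1 * A$3$2"
    "cnj (A$3$1) = A$1$2 * A$2$3 - A$1$3 * A$2$2"
    "cnj (A$3$2) = A$1$3 * A$2$1 - A$1$1 * A$2$3"
    "cnj (A$3$3) = A$1$1 * A$2$2 - A$1$2 * A$2$1"
    by (simp_all add: mat3_eq_iff M_def)
qed

section \<open>A normal form for the fibres of $\Gamma$\<close>

definition PP :: "complex^3^3" where
  "PP = vector [vector [1, 0, 0], vector [0, 1, 0], vector [0, 0, 0]]"

definition EE :: "complex^3^3" where
  "EE = vector [vector [0, 0, 0], vector [0, 0, 0], vector [0, 0, 1]]"

text \<open>The quaternionic structure of the plane, which intertwines SU(2) with its complex
  conjugate, extended by 1 on the last coordinate so that the determinant is 1.\<close>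

definition JJ :: "complex^3^3" where
  "JJ = vector [vector [0, -1, 0], vector [1, 0, 0], vector [0, 0, 1]]"

definition su2_mat :: "real \<Rightarrow> complex \<Rightarrow> complex^3^3" where
  "su2_mat x y = vector [vector [\<i> * of_real x, - cnj y, 0], vector [y, - \<i> * of_real x, 0], vector [0, 0, 0]]"

lemma su2_mat_in [simp]: "su2_mat x y \<in> su2"
  by (simp add: su2_def su2_mat_def mat3_eq_iff trace_def sum_3 forall_3)

lemma su2_cases:
  assumes "X \<in> su2"
  obtains x y where "X = su2_mat x y"
proof
  have h0: "cnj (X$1$1) = - X$1$1" "cnj (X$2$1) = - X$1$2" "X$1$1 + X$2$2 = 0"
    using assms by (auto simp: su2_def mat3_eq_iff trace_def sum_3 forall_3)
  then have h: "cnj (X$1$1) = - X$1$1" "X$1$2 = - cnj (X$2$1)" "X$2$2 = - X$1$1"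
    by (simp_all add: add_eq_0_iff)
  have "X$1$1 = \<i> * of_real (Im (X$1$1))"
    using h(1) by (simp add: complex_eq_iff)
  then show "X = su2_mat (Im (X$1$1)) (X$2$1)"
    using assms h by (simp add: su2_def su2_mat_def mat3_eq_iff forall_3)
qed

definition rho :: "complex^3^3 \<Rightarrow> real" where
  "rho X = 1 + (cmod (X$1$1))\<^sup>2 + (cmod (X$2$1))\<^sup>2"

lemma rho_pos [simp]: "rho X > 0" and rho_nonzero [simp]: "rho X \<noteq> 0"
proof -
  have "rho X \<ge> 1" by (simp add: rho_def)
  then show "rho X > 0" "rho X \<noteq> 0" by linarith+
qed

lemma rho_su2_mat: "complex_of_real (rho (su2_mat x y)) = 1 + (of_real x)\<^sup>2 + y * cnj y"
  by (simp add: rho_def su2_mat_def norm_mult flip: complex_norm_square)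

text \<open>With $r^2 = \det X$ on the upper left block, $X^2 = -r^2$ there, so
  $-(1+X)(1-X)^{-1} = 1 - 2(1+X)/(1+r^2)$; here \<open>rho X\<close> is $1 + r^2$.\<close>

definition cayley :: "complex^3^3 \<Rightarrow> complex^3^3" where
  "cayley X = mat 1 - smul (of_real (2 / rho X)) (PP + X)"

text \<open>The block $s = (1+X)/\sqrt{1+r^2}$ is the square root in $SU(2)$ of $(1+X)(1-X)^{-1}$ with
  positive trace. The antilinear map $x \mapsto s J \overline{x}$ squares to $-s^2$, since $J$ intertwines
  $\overline{s}$ with $s$ and $J^2 = -1$.\<close>

definition root_block :: "complex^3^3 \<Rightarrow> complex \<Rightarrow> complex^3^3" where
  "root_block X z = (smul (z / of_real (sqrt (rho X))) (PP + X) + smul ((cnj z)\<^sup>2) EE) ** JJ"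

text \<open>The pair \<open>u\<close>, \<open>w\<close> is the first column of the block s in SU(2),
  whose second column is \<open>- cnj w\<close>, \<open>cnj u\<close>. The block of
  \<open>cayley X\<close> appears as 1 - tr(s) s, which is -s^2 by Cayley-Hamilton.\<close>

lemma root_block_cayley_cases:
  assumes "X \<in> su2"
  obtains u w where "Re u = 1 / sqrt (rho X)" "u * cnj u + w * cnj w = 1"
    "\<And>z. root_block X z = vector [vector [- z * cnj w, - z * u, 0], vector [z * cnj u, - z * w, 0],
       vector [0, 0, (cnj z)\<^sup>2]]"
    "cayley X = vector [vector [1 - (u + cnj u) * u, (u + cnj u) * cnj w, 0],
       vector [- (u + cnj u) * w, 1 - (u + cnj u) * cnj u, 0], vector [0, 0, 1]]"
proof -
  obtain x y where X: "X = su2_mat x y" using assms(1) su2_cases by blast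
  define t where "t = 1 / sqrt (rho X)"
  define u where "u = complex_of_real t * (1 + \<i> * of_real x)"
  define w where "w = complex_of_real t * y"
  have t2: "t\<^sup>2 = 1 / rho X"
    by (simp add: t_def power_divide less_imp_le)
  then have tt: "2 / rho X = 2 * t\<^sup>2" by simp
  have e: "X$1$1 = \<i> * of_real x" "X$1$2 = - cnj y" "X$1$3 = 0" "X$2$1 = y" "X$2$2 = - \<i> * of_real x"
    "X$2$3 = 0" "X$3$1 = 0" "X$3$2 = 0" "X$3$3 = 0"
    by (simp_all add: X su2_mat_def)
  have uu: "u + cnj u = 2 * of_real t"
    by (simp add: u_def algebra_simps)
  have 1: "Re u = 1 / sqrt (rho X)" by (simp add: u_def t_def)
  have "u * cnj u + w * cnj w = (of_real t)\<^sup>2 * (1 + (of_real x)\<^sup>2 + y * cnj y)"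
    by (simp add: u_def w_def power2_eq_square algebra_simps)
  also have "\<dots> = of_real (t\<^sup>2 * rho X)" by (simp add: X rho_su2_mat)
  finally have 2: "u * cnj u + w * cnj w = 1" by (simp add: t2)
  have c: "z / complex_of_real (sqrt (rho X)) = z * of_real t" for z by (simp add: t_def)
  have 3: "root_block X z = vector [vector [- z * cnj w, - z * u, 0], vector [z * cnj u, - z * w, 0],
       vector [0, 0, (cnj z)\<^sup>2]]" for z
    unfolding root_block_def c u_def w_def
    by (simp add: mat3_eq_iff mm_nth PP_def EE_def JJ_def e algebra_simps)
  have 4: "cayley X = vector [vector [1 - (u + cnj u) * u, (u + cnj u) * cnj w, 0],
       vector [- (u + cnj u) * w, 1 - (u + cnj u) * cnj u, 0], vector [0, 0, 1]]"
    unfolding uu unfolding cayley_def tt u_def w_def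
    by (simp add: mat3_eq_iff mat_nth PP_def e power2_eq_square algebra_simps)
  from 1 2 3 4 show ?thesis by (rule that)
qed

lemma unit_cnj: "cmod z = 1 \<Longrightarrow> z * cnj z = 1"
  by (simp add: complex_norm_square[symmetric])

lemma det_block: "det (vector [vector [a, b, 0], vector [c, d, 0], vector [0, 0, e]] :: complex^3^3) = (a * d - b * c) * e"
  by (simp add: det_3 algebra_simps)

lemma root_block_SU3:
  assumes "X \<in> su2" "cmod z = 1"
  shows "root_block X z \<in> SU3" and Gamma_root_block: "root_block X z ** conj_mat (root_block X z) = cayley X"
proof -
  obtain u w where h: "u * cnj u + w * cnj w = 1"
    "root_block X z = vector [vector [- z * cnj w, - z * u, 0], vector [z * cnj u, - z * w, 0],
       vector [0, 0, (cnj z)\<^sup>2]]"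
    "cayley X = vector [vector [1 - (u + cnj u) * u, (u + cnj u) * cnj w, 0],
       vector [- (u + cnj u) * w, 1 - (u + cnj u) * cnj u, 0], vector [0, 0, 1]]"
    using root_block_cayley_cases[OF assms(1)] by metis
  \<comment> \<open>With the conjugates renamed as independent unknowns, all entrywise claims become
    polynomial consequences of \<open>u * u' + w * w' = 1\<close> and \<open>z * z' = 1\<close>,
    within reach of \<open>algebra\<close>.\<close>
  define z' u' w' where d: "z' = cnj z" "u' = cnj u" "w' = cnj w"
  note z = unit_cnj[OF assms(2), folded d]
  note h = h[folded d]
  have d': "cnj z' = z" "cnj u' = u" "cnj w' = w" by (simp_all add: d)
  have [simp]: "z * (z' * v) = v" for v using z by (simp flip: mult.assoc)
  have det: "det (root_block X z) = 1"
    unfolding h(2) det_block using h(1) z by (simp; algebra)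
  show "root_block X z \<in> SU3"
    using det unfolding h(2) SU_iff mat3_eq_iff mm_nth
    by (simp add: mat_nth d[symmetric] d') (intro conjI; (use h(1) z in algebra)?)
  show "root_block X z ** conj_mat (root_block X z) = cayley X"
    unfolding h mat3_eq_iff mm_nth
    by (simp add: mat_nth d[symmetric] d') (intro conjI; (use h(1) z in algebra)?)
qed

text \<open>The trace is 3 - (tr s)^2. It recovers \<open>rho X\<close>, and it approaches 3, the
  trace of the identity, exactly when X tends to infinity; injectivity modulo the group and
  closedness of \<open>Psi\<close> both rest on this.\<close>

lemma trace_cayley:
  assumes "X \<in> su2"
  shows "trace (cayley X) = of_real (3 - 4 / rho X)"
proof -
  obtain u w where 1: "Re u = 1 / sqrt (rho X)"
    "cayley X = vector [vector [1 - (u + cnj u) * u, (u + cnj u) * cnj w, 0],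
       vector [- (u + cnj u) * w, 1 - (u + cnj u) * cnj u, 0], vector [0, 0, 1]]"
    using root_block_cayley_cases[OF assms] by metis
  have "trace (cayley X) = 3 - (u + cnj u)\<^sup>2"
    by (simp add: 1(2) trace_def sum_3 power2_eq_square algebra_simps)
  also have "u + cnj u = of_real (2 * (1 / sqrt (rho X)))"
    by (simp only: complex_add_cnj 1(1))
  also have "3 - (of_real (2 * (1 / sqrt (rho X))))\<^sup>2 = complex_of_real (3 - (2 * (1 / sqrt (rho X)))\<^sup>2)"
    by (simp only: of_real_power of_real_diff of_real_numeral)
  also have "(2 * (1 / sqrt (rho X)))\<^sup>2 = 4 / rho X"
    by (simp add: power_divide power_mult_distrib less_imp_le)
  finally show ?thesis .
qed

lemma cayley_SU3: "X \<in> su2 \<Longrightarrow> cayley X \<in> SU3"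
  by (metis Gamma_root_block root_block_SU3 SU_conj_mat SU_mult norm_one)

lemma root_block_unique:
  assumes "X \<in> su2" "C \<in> SU3" "C ** conj_mat C = cayley X"
  obtains z where "cmod z = 1" "C = root_block X z"
proof -
  obtain u w where h: "Re u = 1 / sqrt (rho X)" "u * cnj u + w * cnj w = 1"
    "\<And>z. root_block X z = vector [vector [- z * cnj w, - z * u, 0], vector [z * cnj u, - z * w, 0],
       vector [0, 0, (cnj z)\<^sup>2]]"
    "cayley X = vector [vector [1 - (u + cnj u) * u, (u + cnj u) * cnj w, 0],
       vector [- (u + cnj u) * w, 1 - (u + cnj u) * cnj u, 0], vector [0, 0, 1]]"
    using root_block_cayley_cases[OF assms(1)] by metis
  define u' w' q where d: "u' = cnj u" "w' = cnj w" "q = u + cnj u"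
  \<comment> \<open>\<open>q\<close> is the trace of s, positive by the choice of the square root.
    Every linear equation below carries this factor, which may thus be cancelled.\<close>
  have q: "q \<noteq> 0" using h(1) by (simp add: d(3) complex_add_cnj)
  note uw = h(2)[folded d]
  define c11 c12 c13 c21 c22 c23 c31 c32 c33 where c: "c11 = C$1$1" "c12 = C$1$2" "c13 = C$1$3" "c21 = C$2$1" "c22 = C$2$2" "c23 = C$2$3" "c31 = C$3$1" "c32 = C$3$2" "c33 = C$3$3"
  have "cayley X ** transpose C = C"
    using mult_adj_cancel[OF SU_conj_mat[OF assms(2)], of C] assms(3) by (simp add: adj_conj_mat)
  note this[unfolded h(4)[folded d(3), folded d] mat3_eq_iff mm_nth, simplified]
  then have e: "(1 - q * u) * c11 + q * w' * c12 = c11" "(1 - q * u) * c21 + q * w' * c22 = c12"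
    "(1 - q * u) * c31 + q * w' * c32 = c13"
    "- (q * w * c11) + (1 - q * u') * c12 = c21" "- (q * w * c21) + (1 - q * u') * c22 = c22"
    "- (q * w * c31) + (1 - q * u') * c32 = c23" "c13 = c31" "c23 = c32"
    unfolding c by auto
  have s1: "u * c31 = w' * c32"
    using e(3,7) q by (simp add: algebra_simps)
  have "q * (w * c31 + u' * c32) = 0"
    using e(6) unfolding e(8) by (simp add: algebra_simps)
  then have s2: "w * c31 = - u' * c32"
    using q by (simp add: eq_neg_iff_add_eq_0)
  \<comment> \<open>\<open>s1\<close> and \<open>s2\<close> form a homogeneous system for
    \<open>c31\<close> and \<open>c32\<close> with determinant
    \<open>u * u' + w * w' = 1\<close>.\<close>
  have C31: "c31 = 0" using s1 s2 uw by algebra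
  have C32: "c32 = 0" using s1 s2 uw by algebra
  have t1: "u * c11 = w' * c12"
    using e(1) q by (simp add: algebra_simps)
  have "q * (w * c21 + u' * c22) = 0"
    using e(5) by (simp add: algebra_simps)
  then have t2: "w * c21 = - u' * c22"
    using q by (simp add: eq_neg_iff_add_eq_0)
  \<comment> \<open>Found by solving the expected entries \<open>c21 = z * u'\<close> and
    \<open>c22 = - z * w\<close> for \<open>z\<close> by means of
    \<open>u * u' + w * w' = 1\<close>.\<close>
  define z where "z = u * c21 - w' * c22"
  have C21: "c21 = z * u'" using t2 uw unfolding z_def by algebra
  have C22: "c22 = - z * w" using t2 uw unfolding z_def by algebra
  have "c12 = c21 - q * z"
    using e(2) unfolding z_def by (auto simp: algebra_simps)
  then have C12: "c12 = - z * u"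
    by (simp add: C21 d algebra_simps)
  have "q * (w * c11) = (1 - q * u') * c12 - c21"
    using e(4) by (auto simp: algebra_simps)
  also have "\<dots> = - z * q * (1 - u * u')"
    by (simp add: C12 C21 d algebra_simps)
  also have "1 - u * u' = w * w'"
    using uw by (auto simp: algebra_simps)
  finally have "q * (w * c11) = q * (- z * w * w')" by (simp add: algebra_simps)
  then have "w * c11 = - z * w * w'" using q mult_left_cancel by blast
  then have C11: "c11 = - z * w'" using t1 C12 uw by algebra
  have "c11 * cnj (c11) + c12 * cnj (c12) + c13 * cnj (c13) = 1"
    using SU_right[OF assms(2)] by (simp add: mat3_eq_iff mm_nth mat_nth c)
  then have "z * cnj z * (u * cnj u + w * cnj w) = 1"
    unfolding e(7) C31 C11 C12 d by (simp add: algebra_simps)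
  then have z: "z * cnj z = 1" unfolding h(2) by simp
  then have "(cmod z)\<^sup>2 = 1"
    using complex_mod_mult_cnj[of z] by simp
  then have z1: "cmod z = 1"
    by (simp add: power2_eq_1_iff) (smt (verit) norm_ge_zero)
  have "det C = z\<^sup>2 * c33 * (u * u' + w * w')"
    by (simp add: det_3 flip: c) (simp add: e(7,8) C31 C32 C11 C12 C21 C22 power2_eq_square algebra_simps)
  then have "z\<^sup>2 * c33 = 1" using assms(2) uw by (simp add: SU_det)
  then have C33: "c33 = (cnj z)\<^sup>2" using z by algebra
  have "C = root_block X z"
    by (simp add: h(3) mat3_eq_iff flip: c) (simp add: e(7,8) C31 C32 C33 C11 C12 C21 C22 d)
  with z1 show ?thesis by (rule that)
qed

section \<open>Transport of the normal form to an arbitrary unitary frame\<close>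

definition Psi :: "(complex^3^3) \<times> (complex^3^3) \<Rightarrow> complex^3^3" where
  "Psi = (\<lambda>(g, X). g ** cayley X ** adj g)"

text \<open>The frame enters by consimilarity, not by conjugation: in A conj(A) the middle factor
  \<open>transpose g ** conj_mat g\<close> is then the identity, and the outer factors
  \<open>g\<close> and \<open>adj g\<close> conjugate the image.\<close>

definition gamma_root :: "complex^3^3 \<Rightarrow> complex^3^3 \<Rightarrow> complex \<Rightarrow> complex^3^3" where
  "gamma_root g X z = g ** root_block X z ** transpose g"

lemma SU_transpose_conj: "A \<in> SU \<Longrightarrow> transpose A ** conj_mat A = mat 1"
  by (metis SU_left SU_transpose adj_transpose SU_right)

lemma gamma_root_SU3: "g \<in> SU3 \<Longrightarrow> X \<in> su2 \<Longrightarrow> cmod z = 1 \<Longrightarrow> gamma_root g X z \<in> SU3"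
  by (simp add: gamma_root_def SU_mult SU_transpose root_block_SU3)

lemma Gamma_gamma_root:
  assumes "g \<in> SU3" "X \<in> su2" "cmod z = 1"
  shows "Gamma_map (gamma_root g X z) = Psi (g, X)"
proof -
  have "Gamma_map (gamma_root g X z) = g ** root_block X z ** (transpose g ** conj_mat g) ** conj_mat (root_block X z) ** adj g"
    by (simp add: Gamma_map_def gamma_root_def conj_mat_mult conj_mat_transpose matrix_mul_assoc)
  also have "\<dots> = g ** (root_block X z ** conj_mat (root_block X z)) ** adj g"
    by (simp add: SU_transpose_conj[OF assms(1)] matrix_mul_assoc)
  finally show ?thesis using assms by (simp add: Gamma_root_block Psi_def)
qed

lemma gamma_root_exists:
  assumes A: "A \<in> SU3" and g: "g \<in> SU3" and X: "X \<in> su2" and eq: "Gamma_map A = Psi (g, X)"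
  obtains z where "cmod z = 1" "A = gamma_root g X z"
proof -
  define C where "C = adj g ** A ** conj_mat g"
  have AC: "A = g ** C ** transpose g"
  proof -
    have "g ** C ** transpose g = (g ** adj g) ** A ** (conj_mat g ** transpose g)"
      by (simp add: C_def matrix_mul_assoc)
    then show ?thesis
      using SU_right[OF g] SU_right[OF SU_conj_mat[OF g]] by (simp add: adj_conj_mat)
  qed
  have "C ** conj_mat C = adj g ** A ** (conj_mat g ** transpose g) ** conj_mat A ** g"
    by (simp add: C_def conj_mat_mult conj_mat_adj matrix_mul_assoc)
  also have "\<dots> = adj g ** (A ** conj_mat A) ** g"
    using SU_right[OF SU_conj_mat[OF g]] by (simp add: adj_conj_mat matrix_mul_assoc)
  also have "\<dots> = (adj g ** g) ** cayley X ** (adj g ** g)"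
    using eq by (simp add: Gamma_map_def Psi_def matrix_mul_assoc)
  finally have "C ** conj_mat C = cayley X" by (simp add: SU_left[OF g])
  moreover have "C \<in> SU3"
    using A g by (simp add: C_def SU_mult SU_adj SU_conj_mat)
  ultimately obtain z where "cmod z = 1" "C = root_block X z"
    using root_block_unique[OF X] by metis
  with AC show ?thesis using that by (simp add: gamma_root_def)
qed

section \<open>The image of $\Gamma$ and the set $\mathbb{L}$\<close>

definition herm :: "complex^'n \<Rightarrow> complex^'n \<Rightarrow> complex" where
  "herm x y = (\<Sum>i\<in>UNIV. x$i * cnj (y$i))"

definition conj_vec :: "complex^'n \<Rightarrow> complex^'n" where
  "conj_vec x = (\<chi> i. cnj (x$i))"

lemma conj_vec_nth [simp]: "conj_vec x $ i = cnj (x $ i)"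
  by (simp add: conj_vec_def)

lemma herm_self: "herm x x = of_real ((norm x)\<^sup>2)"
  by (simp add: herm_def norm_vec_def L2_set_def sum_nonneg complex_norm_square[symmetric])

lemma herm_add: "herm (x + y) z = herm x z + herm y z"
  and herm_scale: "herm (c *s x) z = c * herm x z"
  and herm_scale_right: "herm x (c *s z) = cnj c * herm x z"
  and herm_conj_vec: "herm (conj_vec x) (conj_vec y) = cnj (herm x y)"
  by (simp_all add: herm_def sum.distrib sum_distrib_left algebra_simps)

lemma herm_adj: "herm (A *v x) y = herm x (adj A *v y)"
  unfolding herm_def matrix_vector_mult_def
  by (simp add: sum_distrib_left sum_distrib_right mult.assoc mult.left_commute) (rule sum.swap)

lemma herm_SU: "A \<in> SU \<Longrightarrow> herm (A *v x) (A *v y) = herm x y"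
  by (simp add: herm_adj matrix_vector_mul_assoc SU_left)

lemma conj_vec_mult: "conj_vec (A *v x) = conj_mat A *v conj_vec x"
  by (simp add: vec_eq_iff matrix_vector_mult_def)

text \<open>The missing column is the conjugated cross product of \<open>w\<close> and
  \<open>v\<close>. It is orthogonal to both, has length 1 by Lagrange's identity
  (\<open>lag\<close>), and its squared length is also the determinant. The frame is assembled by
  rows and transposed at the end.\<close>

lemma SU3_columns:
  assumes "herm v v = 1" "herm w w = 1" "herm w v = 0"
  obtains g where "g \<in> SU3" "\<And>i. g$i$2 = w$i" "\<And>i. g$i$3 = v$i"
proof -
  define A :: "complex^3^3" where "A = vector [vector
    [cnj (w$2 * v$3 - w$3 * v$2), cnj (w$3 * v$1 - w$1 * v$3), cnj (w$1 * v$2 - w$2 * v$1)],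
    vector [w$1, w$2, w$3], vector [v$1, v$2, v$3]]"
  have vv: "v$1 * cnj (v$1) + v$2 * cnj (v$2) + v$3 * cnj (v$3) = 1"
    and ww: "w$1 * cnj (w$1) + w$2 * cnj (w$2) + w$3 * cnj (w$3) = 1"
    and wv: "w$1 * cnj (v$1) + w$2 * cnj (v$2) + w$3 * cnj (v$3) = 0"
    using assms by (simp_all add: herm_def sum_3)
  have vw: "v$1 * cnj (w$1) + v$2 * cnj (w$2) + v$3 * cnj (w$3) = 0"
    using arg_cong[OF wv, of cnj] by (simp add: mult.commute)
  have lag: "cnj (w$2 * v$3 - w$3 * v$2) * (w$2 * v$3 - w$3 * v$2) +
      cnj (w$3 * v$1 - w$1 * v$3) * (w$3 * v$1 - w$1 * v$3) +
      cnj (w$1 * v$2 - w$2 * v$1) * (w$1 * v$2 - w$2 * v$1) = 1" (is "?L = 1")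
  proof -
    have "?L = (w$1 * cnj (w$1) + w$2 * cnj (w$2) + w$3 * cnj (w$3)) *
        (v$1 * cnj (v$1) + v$2 * cnj (v$2) + v$3 * cnj (v$3)) -
        (w$1 * cnj (v$1) + w$2 * cnj (v$2) + w$3 * cnj (v$3)) *
        (v$1 * cnj (w$1) + v$2 * cnj (w$2) + v$3 * cnj (w$3))"
      by (simp add: algebra_simps)
    then show ?thesis by (simp only: vv ww wv) simp
  qed
  have "A ** adj A = mat 1"
    unfolding mat3_eq_iff mm_nth A_def
    using lag vv ww wv vw
    by (simp add: mat_nth algebra_simps)
  moreover have "det A = 1"
    using lag by (simp add: det_3 A_def algebra_simps)
  ultimately have "A \<in> SU3" by (simp add: SU_iff)
  show ?thesis
  proof
    show "transpose A \<in> SU3" using \<open>A \<in> SU3\<close> by (rule SU_transpose)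
    show "transpose A $ i $ 2 = w $ i" "transpose A $ i $ 3 = v $ i" for i
      using exhaust_3[of i] by (auto simp: A_def)
  qed
qed

lemma normalize_vector:
  fixes x :: "complex^'n"
  assumes "x \<noteq> 0"
  shows "herm (of_real (1 / norm x) *s x) (of_real (1 / norm x) *s x) = 1"
proof -
  have "herm (of_real (1 / norm x) *s x) (of_real (1 / norm x) *s x) = complex_of_real ((1 / norm x) * (1 / norm x) * (norm x)\<^sup>2)"
    by (subst herm_scale, subst herm_scale_right, subst herm_self) simp
  also have "(1 / norm x) * (1 / norm x) * (norm x)\<^sup>2 = 1"
    using assms by (simp add: power2_eq_square)
  finally show ?thesis by simp
qed

lemma orthogonal_vector:
  fixes v :: "complex^3"
  obtains w where "herm w w = 1" "herm w v = 0"
proof -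
  obtain x :: "complex^3" where "x \<noteq> 0" "herm x v = 0"
  proof (cases "v$1 = 0 \<and> v$2 = 0")
    case True
    show ?thesis
      by (rule that[of "vector [1, 0, 0]"]) (use True in \<open>simp_all add: herm_def sum_3 vec_eq_iff forall_3\<close>)
  next
    case False
    show ?thesis
      by (rule that[of "vector [- cnj (v$2), cnj (v$1), 0]"])
        (use False in \<open>auto simp add: herm_def sum_3 vec_eq_iff forall_3\<close>)
  qed
  then show ?thesis
    using that normalize_vector[of x] by (metis herm_scale mult_zero_right)
qed

lemma SU3_last_column:
  fixes v :: "complex^3"
  assumes "herm v v = 1"
  obtains g where "g \<in> SU3" "\<And>i. g$i$3 = v$i"
  by (metis SU3_columns assms orthogonal_vector)

text \<open>The cofactor identities express the conjugated first column through the other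
  two.\<close>

lemma SU3_eq_if_two_columns_eq:
  assumes "g \<in> SU3" "h \<in> SU3" "\<And>i. g$i$2 = h$i$2" "\<And>i. g$i$3 = h$i$3"
  shows "g = h"
proof -
  have "cnj (g$1$1) = cnj (h$1$1)" "cnj (g$2$1) = cnj (h$2$1)" "cnj (g$3$1) = cnj (h$3$1)"
    using SU3_minors[OF assms(1)] SU3_minors[OF assms(2)] assms(3,4) by simp_all
  then show ?thesis using assms(3,4) by (simp add: mat3_eq_iff)
qed

section \<open>The fibre over the identity\<close>

text \<open>For symmetric \<open>A\<close> the map \<open>x \<mapsto> A *v conj_vec x\<close> is an antilinear involution; its fixed
  vectors form a real form of $\mathbb{C}^3$, from which \<open>A = g ** transpose g\<close> is read off.\<close>

lemma fixed_unit_vector: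
  fixes A :: "complex^3^3"
  assumes "A ** conj_mat A = mat 1" "x \<noteq> 0"
  obtains v a b where "herm v v = 1" "A *v conj_vec v = v" "v = a *s x + b *s (A *v conj_vec x)"
proof -
  define \<tau> where "\<tau> y = A *v conj_vec y" for y
  have \<tau>\<tau>: "\<tau> (\<tau> y) = y" for y
    using assms(1)
    by (simp add: \<tau>_def conj_vec_mult matrix_vector_mul_assoc) (simp add: vec_eq_iff)
  have \<tau>_add: "\<tau> (y + z) = \<tau> y + \<tau> z" for y z
    by (simp add: \<tau>_def vec_eq_iff matrix_vector_mult_def sum.distrib algebra_simps)
  have \<tau>_scale: "\<tau> (c *s y) = cnj c *s \<tau> y" for c y
    by (simp add: \<tau>_def vec_eq_iff matrix_vector_mult_def sum_distrib_left algebra_simps)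
  obtain y a b where y: "y \<noteq> 0" "\<tau> y = y" "y = a *s x + b *s \<tau> x"
  proof (cases "x + \<tau> x = 0")
    \<comment> \<open>Here x + \<tau> x cannot be used. Since \<tau> is antilinear, \<tau> x = - x
      makes \<open>\<i> *s x\<close> a fixed vector.\<close>
    case True
    then have \<tau>x: "\<tau> x = - x" by (simp add: add_eq_0_iff)
    show ?thesis
      by (rule that[of "\<i> *s x" \<i> 0]) (use \<tau>x assms(2) in \<open>simp_all add: \<tau>_scale vector_mul_eq_0\<close>)
  next
    case False
    show ?thesis
      by (rule that[of "x + \<tau> x" 1 1]) (use False in \<open>simp_all add: \<tau>_add \<tau>\<tau>\<close>)
  qed
  \<comment> \<open>The normalising factor is real, so it commutes with the antilinear map and the
    vector stays fixed.\<close>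
  let ?c = "complex_of_real (1 / norm y)"
  show ?thesis
  proof
    show "herm (?c *s y) (?c *s y) = 1" by (rule normalize_vector[OF y(1)])
    show "A *v conj_vec (?c *s y) = ?c *s y"
      using \<tau>_scale[of ?c y] y(2) by (simp add: \<tau>_def)
    show "?c *s y = (?c * a) *s x + (?c * b) *s (A *v conj_vec x)"
      using y(3) by (simp add: \<tau>_def vector_add_ldistrib)
  qed
qed

lemma Gamma_map_eq_one_imp_LL:
  assumes A: "A \<in> SU3" and "Gamma_map A = mat 1"
  shows "A \<in> LL"
proof -
  have A1: "A ** conj_mat A = mat 1" using assms by (simp add: Gamma_map_def)
  have "axis 1 1 \<noteq> (0 :: complex^3)" by (simp add: axis_eq_0_iff)
  then obtain v where v: "herm v v = 1" "A *v conj_vec v = v"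
    using fixed_unit_vector[OF A1] by metis
  obtain y where y: "herm y y = 1" "herm y v = 0" by (rule orthogonal_vector)
  then have "y \<noteq> 0" by (auto simp: herm_def)
  then obtain w a b where w: "herm w w = 1" "A *v conj_vec w = w" "w = a *s y + b *s (A *v conj_vec y)"
    using fixed_unit_vector[OF A1] by metis
  \<comment> \<open>The antilinear map preserves \<open>herm\<close> up to conjugation and fixes
    \<open>v\<close>, so it preserves the orthogonal complement of \<open>v\<close>. As
    \<open>w\<close> lies in the span of \<open>y\<close> and its image, it is still orthogonal to
    \<open>v\<close>.\<close>
  have "herm (A *v conj_vec y) v = herm (A *v conj_vec y) (A *v conj_vec v)" by (simp add: v(2))
  also have "\<dots> = cnj (herm y v)" by (simp add: herm_SU[OF A] herm_conj_vec)
  finally have "herm w v = 0" by (simp add: w(3) herm_add herm_scale y(2))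
  then obtain g where g: "g \<in> SU3" "\<And>i. g$i$2 = w$i" "\<And>i. g$i$3 = v$i"
    using SU3_columns v(1) w(1) by metis
  \<comment> \<open>Only the last two columns of \<open>g\<close> were built from fixed vectors;
    membership in SU(3) takes care of the first.\<close>
  have "A ** conj_mat g = g"
  proof (rule SU3_eq_if_two_columns_eq)
    show "A ** conj_mat g \<in> SU3" using A g(1) by (simp add: SU_mult SU_conj_mat)
    show "(A ** conj_mat g) $ i $ 2 = g $ i $ 2" for i
      using arg_cong[OF w(2), of "\<lambda>x. x $ i"] by (simp add: g mm_nth matrix_vector_mult_def sum_3)
    show "(A ** conj_mat g) $ i $ 3 = g $ i $ 3" for i
      using arg_cong[OF v(2), of "\<lambda>x. x $ i"] by (simp add: g mm_nth matrix_vector_mult_def sum_3)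
  qed (rule g)
  then have "A = g ** transpose g"
    using mult_adj_cancel[OF SU_conj_mat[OF g(1)], of A] by (simp add: adj_conj_mat)
  then show ?thesis using g(1) by (auto simp: LL_def)
qed

lemma Gamma_map_LL: "A \<in> LL \<Longrightarrow> Gamma_map A = mat 1"
proof -
  assume "A \<in> LL"
  then obtain g where g: "g \<in> SU3" "A = g ** transpose g" by (auto simp: LL_def)
  have "Gamma_map A = g ** (transpose g ** conj_mat g) ** adj g"
    by (simp add: Gamma_map_def g(2) conj_mat_mult conj_mat_transpose matrix_mul_assoc)
  then show ?thesis using g(1) by (simp add: SU_transpose_conj SU_right)
qed

section \<open>Spectral normal form on \<open>HH\<close> and the image of
  \<open>Gamma_map\<close>\<close>

text \<open>By the cofactor identities the sum of the principal 2x2 minors is the conjugate of the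
  trace. Hence det(B - 1) = tr B - cnj(tr B), which vanishes for a real trace.\<close>

lemma trace_in_Reals_imp_fixed_vector:
  assumes B: "B \<in> HH"
  obtains v where "herm v v = 1" "B *v v = v"
proof -
  have SU: "B \<in> SU3" and tr: "trace B \<in> \<real>" using B by (auto simp: HH_def)
  have "det (B - mat 1) = det B - (B$2$2 * B$3$3 - B$2$3 * B$3$2) - (B$1$1 * B$3$3 - B$1$3 * B$3$1)
      - (B$1$1 * B$2$2 - B$1$2 * B$2$1) + trace B - 1"
    by (simp add: det_3 mat_nth trace_def sum_3 algebra_simps)
  also have "\<dots> = 1 - cnj (trace B) + trace B - 1"
    using SU3_minors(1,5,9)[OF SU] by (simp add: SU_det[OF SU] trace_def sum_3)
  also have "\<dots> = 0" using tr by (simp add: Reals_cnj_iff)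
  finally have "\<not> invertible (B - mat 1)" by (simp add: invertible_det_nz)
  then obtain x where x: "(B - mat 1) *v x = 0" "x \<noteq> 0"
    by (metis invertible_left_inverse matrix_left_invertible_ker)
  then have Bx: "B *v x = x" by (simp add: matrix_vector_mult_diff_rdistrib)
  show ?thesis
  proof
    show "herm (of_real (1 / norm x) *s x) (of_real (1 / norm x) *s x) = 1"
      by (rule normalize_vector[OF x(2)])
    show "B *v (of_real (1 / norm x) *s x) = of_real (1 / norm x) *s x"
      by (simp add: vector_scalar_commute Bx)
  qed
qed

lemma SU3_fixing_last:
  assumes C: "C \<in> SU3" and "C$1$3 = 0" "C$2$3 = 0" "C$3$3 = 1" "trace C \<in> \<real>" "C \<noteq> mat 1"
  obtains X where "X \<in> su2" "C = cayley X"
proof -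
  note m = SU3_minors[OF C]
  have "C$3$1 * cnj (C$3$1) + C$3$2 * cnj (C$3$2) + C$3$3 * cnj (C$3$3) = 1"
    using SU_right[OF C] by (simp add: mat3_eq_iff mm_nth mat_nth)
  then have "of_real ((cmod (C$3$1))\<^sup>2 + (cmod (C$3$2))\<^sup>2) = complex_of_real 0"
    using assms(4) by (simp add: complex_norm_square del: of_real_power)
  then have z: "C$3$1 = 0" "C$3$2 = 0"
    unfolding of_real_eq_iff by (simp_all add: add_nonneg_eq_0_iff)
  have c: "C$2$2 = cnj (C$1$1)" "C$1$2 = - cnj (C$2$1)"
    using m(1) m(2) m(4) assms z by simp_all
  define a b y where "a = Re (C$1$1)" "b = Im (C$1$1)" "y = C$2$1"
  have c11: "C$1$1 = Complex a b" by (simp add: a_b_y_def)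
  have "C$1$1 * cnj (C$1$1) + C$2$1 * cnj (C$2$1) = 1"
    using SU_det[OF C] assms z c by (simp add: det_3 algebra_simps)
  then have "complex_of_real ((cmod (C$1$1))\<^sup>2 + (cmod (C$2$1))\<^sup>2) = complex_of_real 1"
    by (simp add: complex_norm_square del: of_real_power)
  then have n: "a\<^sup>2 + b\<^sup>2 + (cmod y)\<^sup>2 = 1"
    unfolding of_real_eq_iff by (simp add: c11 cmod_def a_b_y_def(3))
  have a: "a < 1"
  proof (rule ccontr)
    assume "\<not> a < 1"
    then have "a \<ge> 1" by simp
    then have "a\<^sup>2 \<ge> 1" by (simp add: one_le_power)
    moreover have "b\<^sup>2 \<ge> 0" "(cmod y)\<^sup>2 \<ge> 0" by simp_all
    ultimately have "a\<^sup>2 = 1" "b\<^sup>2 = 0" "(cmod y)\<^sup>2 = 0" using n by linarith+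
    then have "a = 1" "b = 0" "y = 0" using \<open>a \<ge> 1\<close> by (simp_all add: power2_eq_1_iff)
    then have "C = mat 1"
      using assms z c c11 by (simp add: mat3_eq_iff mat_nth a_b_y_def(3) complex_eq_iff)
    then show False using assms by simp
  qed
  \<comment> \<open>Solves C = 1 - (2/rho)(1 + X) on the block: the real part of the diagonal forces
    2/rho = 1 - a, and the other coordinates are then divided by -(1 - a), which is non-zero because
    C is not the identity.\<close>
  define X where "X = su2_mat (- b / (1 - a)) (- y / of_real (1 - a))"
  have "rho X = 1 + (b\<^sup>2 + (cmod y)\<^sup>2) / (1 - a)\<^sup>2"
    using a by (simp add: rho_def X_def su2_mat_def norm_mult norm_divide power_divide add_divide_distrib power_mult_distrib
      del: of_real_divide of_real_minus of_real_diff)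
  also have "b\<^sup>2 + (cmod y)\<^sup>2 = (1 - a) * (1 + a)"
    using n by (simp add: power2_eq_square algebra_simps)
  also have "1 + (1 - a) * (1 + a) / (1 - a)\<^sup>2 = 2 / (1 - a)"
    using a by (simp add: power2_eq_square divide_simps)
  finally have r: "2 / rho X = 1 - a" using a by simp
  have na: "complex_of_real (1 - a) \<noteq> 0" using a unfolding of_real_eq_0_iff by simp
  have "C = cayley X"
    unfolding cayley_def r using na assms z c
    by (simp add: mat3_eq_iff PP_def X_def su2_mat_def mat_nth c11 complex_eq_iff a_b_y_def(3)
      del: of_real_diff)
  moreover have "X \<in> su2" by (simp add: X_def)
  ultimately show ?thesis using that by blast
qed

lemma mult_last_column:
  fixes B :: "complex^3^'n"
  assumes "\<And>i. g$i$3 = v$i"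
  shows "(B ** g) $ i $ 3 = (B *v v) $ i"
  by (simp add: mm_nth matrix_vector_mult_def sum_3 assms)

text \<open>In the frame \<open>g\<close> the matrix fixes the last basis vector, so the block form
  applies. The frame is prescribed rather than produced: any completion of a fixed unit vector will
  do, which the local sections exploit.\<close>

lemma Psi_surj_frame:
  assumes B: "B \<in> HH" "B \<noteq> mat 1" and g: "g \<in> SU3" "\<And>i. g$i$3 = v$i" and v: "B *v v = v"
  obtains X where "X \<in> su2" "B = Psi (g, X)"
proof -
  have SU: "B \<in> SU3" and tr: "trace B \<in> \<real>" using B by (auto simp: HH_def)
  define C where "C = adj g ** B ** g"
  have BC: "B = g ** C ** adj g"
  proof -
    have "g ** C ** adj g = (g ** adj g) ** B ** (g ** adj g)"
      by (simp add: C_def matrix_mul_assoc)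
    then show ?thesis by (simp add: SU_right[OF g(1)])
  qed
  have "C $ i $ 3 = mat 1 $ i $ 3" for i
  proof -
    have "(B ** g) $ j $ 3 = g $ j $ 3" for j
      using mult_last_column[OF g(2), of B j] by (simp add: v g(2))
    then have "C $ i $ 3 = (adj g ** g) $ i $ 3"
      by (simp add: C_def mm_nth flip: matrix_mul_assoc)
    then show ?thesis by (simp add: SU_left[OF g(1)])
  qed
  then have c: "C$1$3 = 0" "C$2$3 = 0" "C$3$3 = 1" by (simp_all add: mat_nth)
  have "C \<in> SU3" using SU g(1) by (simp add: C_def SU_mult SU_adj)
  moreover have "trace C = trace B"
    unfolding C_def by (subst trace_mul_sym) (simp add: matrix_mul_assoc SU_right[OF g(1)])
  moreover have "C \<noteq> mat 1" using B(2) BC by (auto simp: SU_right[OF g(1)])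
  ultimately obtain X where "X \<in> su2" "C = cayley X"
    using SU3_fixing_last[of C] c tr by metis
  with BC that show ?thesis by (simp add: Psi_def)
qed

lemma trace_Psi:
  assumes "g \<in> SU3" "X \<in> su2"
  shows "trace (Psi (g, X)) = of_real (3 - 4 / rho X)"
  unfolding Psi_def prod.case
  by (subst trace_mul_sym) (simp add: matrix_mul_assoc SU_left assms trace_cayley)

lemma Psi_in_HH:
  assumes "g \<in> SU3" "X \<in> su2"
  shows "Psi (g, X) \<in> HH - {mat 1}"
proof -
  have "Psi (g, X) \<in> SU3" using assms by (simp add: Psi_def SU_mult SU_adj cayley_SU3)
  moreover have "trace (Psi (g, X)) \<noteq> trace (mat 1 :: complex^3^3)"
  proof
    assume "trace (Psi (g, X)) = trace (mat 1 :: complex^3^3)"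
    then have "complex_of_real (3 - 4 / rho X) = of_real 3"
      using trace_Psi[OF assms] by (simp add: trace_def sum_3 mat_nth)
    then have "3 - 4 / rho X = 3" by (simp only: of_real_eq_iff)
    then show False by simp
  qed
  ultimately show ?thesis using trace_Psi[OF assms] by (auto simp: HH_def)
qed

lemma Psi_image: "Psi ` (SU3 \<times> su2) = HH - {mat 1}"
proof (intro equalityI subsetI)
  fix B assume B: "B \<in> HH - {mat 1}"
  then obtain v where v: "herm v v = 1" "B *v v = v"
    using trace_in_Reals_imp_fixed_vector by blast
  then obtain g where g: "g \<in> SU3" "\<And>i. g$i$3 = v$i" using SU3_last_column by metis
  obtain X where "X \<in> su2" "B = Psi (g, X)"
    using Psi_surj_frame[OF _ _ g v(2)] B by blast
  then show "B \<in> Psi ` (SU3 \<times> su2)" using g(1) by blast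
qed (use Psi_in_HH in auto)

lemma Gamma_map_in_HH:
  assumes "A \<in> SU3"
  shows "Gamma_map A \<in> HH"
proof -
  have "Gamma_map A \<in> SU3" by (simp add: Gamma_map_def SU_mult SU_conj_mat assms)
  moreover have "cnj (trace (Gamma_map A)) = trace (conj_mat A ** A)"
    by (simp add: Gamma_map_def trace_def sum_3 mm_nth)
  moreover have "trace (conj_mat A ** A) = trace (Gamma_map A)"
    unfolding Gamma_map_def by (rule trace_mul_sym)
  ultimately show ?thesis
    by (simp add: HH_def Reals_cnj_iff)
qed

lemma Gamma_map_image: "Gamma_map ` SU3 = HH"
proof (intro equalityI subsetI)
  fix B assume B: "B \<in> HH"
  show "B \<in> Gamma_map ` SU3"
  proof (cases "B = mat 1")
    case True
    then have "B = Gamma_map (mat 1)" by (simp add: Gamma_map_def conj_mat_mat)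
    then show ?thesis using SU_one by blast
  next
    case False
    then obtain g X where "g \<in> SU3" "X \<in> su2" "B = Psi (g, X)"
      using B Psi_image by blast
    then have "B = Gamma_map (gamma_root g X 1)" "gamma_root g X 1 \<in> SU3"
      by (simp_all add: Gamma_gamma_root gamma_root_SU3)
    then show ?thesis by blast
  qed
qed (use Gamma_map_in_HH in auto)

lemma mem_SU3_diff_LL: "A \<in> SU3 - LL \<longleftrightarrow> A \<in> SU3 \<and> Gamma_map A \<in> HH - {mat 1}"
  using Gamma_map_LL[of A] Gamma_map_eq_one_imp_LL[of A] Gamma_map_in_HH[of A] by blast

section \<open>$\mathcal{H}$ as a Thom space\<close>

lemma trace_mult_adj: "trace (A ** adj A) = of_real ((norm A)\<^sup>2)" for A :: "complex^'n^'m"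
  by (simp add: trace_def matrix_matrix_mult_def norm_vec_def L2_set_def sum_nonneg complex_norm_square
      del: of_real_power)

lemma su2_adj: "X \<in> su2 \<Longrightarrow> adj X = - X"
  by (simp add: su2_def adj_def)

text \<open>Writes \<open>rho\<close> through a trace, so that its invariance under conjugation and
  its relation to the norm follow from trace identities.\<close>

lemma trace_su2_square:
  assumes "X \<in> su2"
  shows "trace (X ** X) = of_real (2 - 2 * rho X)"
proof -
  obtain x y where X: "X = su2_mat x y" using su2_cases[OF assms] by blast
  show ?thesis
    by (simp add: X rho_su2_mat) (simp add: su2_mat_def trace_def sum_3 mm_nth power2_eq_square algebra_simps)
qed

lemma norm_su2: assumes "X \<in> su2" shows "(norm X)\<^sup>2 = 2 * rho X - 2"
proof -
  have "complex_of_real ((norm X)\<^sup>2) = trace (X ** (- X))"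
    using trace_mult_adj[of X] by (simp add: su2_adj[OF assms])
  also have "\<dots> = - trace (X ** X)"
    by (simp add: trace_def matrix_matrix_mult_def sum_negf)
  finally have "complex_of_real ((norm X)\<^sup>2) = of_real (2 * rho X - 2)"
    using trace_su2_square[OF assms] by simp
  then show ?thesis unfolding of_real_eq_iff .
qed

section \<open>The isotropy group and the fibres of \<open>Psi\<close>\<close>

lemma S_U2_U1_SU3: "h \<in> S_U2_U1 \<Longrightarrow> h \<in> SU3"
  by (simp add: S_U2_U1_def)

text \<open>Block form as commutation with a projection: in this shape membership is stable under
  products and can be recognised in an equation between conjugates.\<close>

lemma S_U2_U1_iff: "h \<in> S_U2_U1 \<longleftrightarrow> h \<in> SU3 \<and> PP ** h = h ** PP"
  by (auto simp: S_U2_U1_def PP_def mat3_eq_iff mm_nth)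

lemma S_U2_U1_one: "mat 1 \<in> S_U2_U1"
  by (simp add: S_U2_U1_iff SU_one)

lemma S_U2_U1_mult: "h \<in> S_U2_U1 \<Longrightarrow> k \<in> S_U2_U1 \<Longrightarrow> h ** k \<in> S_U2_U1"
  by (simp add: S_U2_U1_iff SU_mult) (metis matrix_mul_assoc)

lemma S_U2_U1_adj: "h \<in> S_U2_U1 \<Longrightarrow> adj h \<in> S_U2_U1"
  by (auto simp: S_U2_U1_def SU_adj)

lemma conj_su2:
  assumes h: "h \<in> S_U2_U1" and X: "X \<in> su2"
  shows "adj h ** X ** h \<in> su2" and "rho (adj h ** X ** h) = rho X"
proof -
  note SU = S_U2_U1_SU3[OF h]
  have "adj (adj h ** X ** h) = - (adj h ** X ** h)"
    by (simp add: adj_mult su2_adj[OF X] matrix_mul_assoc) (simp add: vec_eq_iff matrix_matrix_mult_def sum_negf)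
  moreover have "trace (adj h ** X ** h) = 0"
    using X by (subst trace_mul_sym) (simp add: matrix_mul_assoc SU_right[OF SU] su2_def)
  moreover have "\<forall>i. (adj h ** X ** h)$i$3 = 0 \<and> (adj h ** X ** h)$3$i = 0"
    using h X by (simp add: mm_nth S_U2_U1_def su2_def)
  ultimately show *: "adj h ** X ** h \<in> su2" by (simp add: su2_def adj_def)
  have "(adj h ** X ** h) ** (adj h ** X ** h) = adj h ** X ** (h ** adj h) ** X ** h"
    by (simp add: matrix_mul_assoc)
  also have "\<dots> = adj h ** (X ** X ** h)"
    by (simp add: SU_right[OF SU] matrix_mul_assoc)
  finally have "trace ((adj h ** X ** h) ** (adj h ** X ** h)) = trace (adj h ** (X ** X ** h))" by simp
  also have "\<dots> = trace (X ** X)"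
    by (subst trace_mul_sym) (simp add: mult_adj_cancel[OF SU])
  finally have "complex_of_real (2 - 2 * rho (adj h ** X ** h)) = of_real (2 - 2 * rho X)"
    by (simp only: trace_su2_square[OF *] trace_su2_square[OF X])
  then show "rho (adj h ** X ** h) = rho X" unfolding of_real_eq_iff by simp
qed

lemma cayley_conj:
  assumes h: "h \<in> S_U2_U1" and X: "X \<in> su2"
  shows "cayley (adj h ** X ** h) = adj h ** cayley X ** h"
proof -
  note SU = S_U2_U1_SU3[OF h]
  have "adj h ** PP ** h = PP"
    using h by (simp add: S_U2_U1_iff flip: matrix_mul_assoc) (simp add: matrix_mul_assoc SU_left)
  then show ?thesis
    by (simp add: cayley_def conj_su2[OF assms] mm_diff_left mm_diff_right smul_mult_left smul_mult_right
        matrix_add_ldistrib mm_add_left SU_left[OF SU])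
qed

lemma Psi_act:
  assumes "h \<in> S_U2_U1" "X \<in> su2"
  shows "Psi (g ** h, adj h ** X ** h) = Psi (g, X)"
proof -
  have "Psi (g ** h, adj h ** X ** h) = g ** (h ** adj h) ** cayley X ** (h ** adj h) ** adj g"
    by (simp add: Psi_def cayley_conj[OF assms] adj_mult matrix_mul_assoc)
  then show ?thesis by (simp add: Psi_def SU_right S_U2_U1_SU3 assms)
qed

text \<open>Equal traces give equal \<open>rho\<close>, so conjugation by
  \<open>h = adj g ** g'\<close> takes \<open>PP + X\<close> to \<open>PP + X'\<close>. Here
  \<open>PP\<close> is Hermitian and \<open>X\<close>, \<open>X'\<close> are skew; comparing with
  the adjoint equation separates the two parts. The Hermitian part says that \<open>h\<close>
  commutes with \<open>PP\<close>, the skew part gives \<open>X'\<close>.\<close>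

lemma Psi_eq_imp:
  assumes g: "g \<in> SU3" "g' \<in> SU3" and X: "X \<in> su2" "X' \<in> su2" and eq: "Psi (g, X) = Psi (g', X')"
  obtains h where "h \<in> S_U2_U1" "g' = g ** h" "X' = adj h ** X ** h"
proof
  define h where "h = adj g ** g'"
  have h: "h \<in> SU3" using g by (simp add: h_def SU_mult SU_adj)
  show g': "g' = g ** h" by (simp add: h_def matrix_mul_assoc SU_right[OF g(1)])
  have "complex_of_real (3 - 4 / rho X) = of_real (3 - 4 / rho X')"
    using trace_Psi[OF g(1) X(1)] trace_Psi[OF g(2) X(2)] eq by simp
  then have "3 - 4 / rho X = 3 - 4 / rho X'" unfolding of_real_eq_iff .
  then have "4 / rho X = 4 / rho X'" by simp
  then have r: "rho X' = rho X" by (simp only: divide_cancel_left) simp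
  define a where "a = complex_of_real (2 / rho X)"
  have a: "a \<noteq> 0" "cnj a = a" by (simp_all add: a_def)
  have cX: "cayley X = mat 1 - smul a (PP + X)" "cayley X' = mat 1 - smul a (PP + X')"
    by (simp_all add: cayley_def r a_def)
  have "adj h ** cayley X ** h = adj g' ** Psi (g, X) ** g'"
    by (simp add: h_def Psi_def adj_mult matrix_mul_assoc)
  also have "\<dots> = (adj g' ** g') ** cayley X' ** (adj g' ** g')"
    unfolding eq by (simp add: Psi_def matrix_mul_assoc)
  also have "\<dots> = cayley X'" by (simp add: SU_left[OF g(2)])
  finally have "adj h ** cayley X ** h = cayley X'" .
  then have "mat 1 - smul a (adj h ** PP ** h + adj h ** X ** h) = mat 1 - smul a (PP + X')"
    by (simp add: cX mm_diff_left mm_diff_right smul_mult_left smul_mult_right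
        matrix_add_ldistrib mm_add_left SU_left[OF h])
  then have 1: "adj h ** PP ** h + adj h ** X ** h = PP + X'"
    using a(1) by (simp add: vec_eq_iff)
  have PPa: "adj PP = PP" by (simp add: PP_def mat3_eq_iff)
  have "adj (adj h ** PP ** h + adj h ** X ** h) = adj h ** PP ** h - adj h ** X ** h"
    by (simp add: adj_add adj_mult su2_adj[OF X(1)] PPa matrix_mul_assoc)
      (simp add: vec_eq_iff matrix_matrix_mult_def sum_negf)
  then have 2: "adj h ** PP ** h - adj h ** X ** h = PP - X'"
    unfolding 1 by (simp add: adj_add su2_adj[OF X(2)] PPa)
  show "X' = adj h ** X ** h"
    using arg_cong2[OF 1 2, of "(-)"] by (simp add: vec_eq_iff)
  then have "adj h ** PP ** h = PP" using 1 by simp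
  then have "h ** PP = h ** (adj h ** (PP ** h))" by (simp add: matrix_mul_assoc)
  also have "\<dots> = PP ** h" by (simp add: matrix_mul_assoc SU_right[OF h])
  finally show "h \<in> S_U2_U1" using h by (simp add: S_U2_U1_iff)
qed

lemma assoc_class_eq: "assoc_class (g, X) = {(g ** h, adj h ** X ** h) | h. h \<in> S_U2_U1}"
  by (auto simp: assoc_class_def SU_matrix_inv S_U2_U1_SU3)

lemma assoc_class_eq_iff:
  assumes "p \<in> SU3 \<times> su2" "p' \<in> SU3 \<times> su2"
  shows "assoc_class p = assoc_class p' \<longleftrightarrow> Psi p = Psi p'"
proof -
  obtain g X g' X' where p: "p = (g, X)" "p' = (g', X')" "g \<in> SU3" "X \<in> su2" "g' \<in> SU3" "X' \<in> su2"
    using assms by auto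
  show ?thesis
  proof
    assume eq: "assoc_class p = assoc_class p'"
    have "p \<in> assoc_class p"
      using S_U2_U1_one by (force simp: p(1) assoc_class_eq adj_mat)
    then obtain h where "h \<in> S_U2_U1" "p = (g' ** h, adj h ** X' ** h)"
      unfolding eq unfolding p(2) assoc_class_eq by blast
    then show "Psi p = Psi p'" using Psi_act p by simp
  next
    assume "Psi p = Psi p'"
    then obtain h where h: "h \<in> S_U2_U1" "g' = g ** h" "X' = adj h ** X ** h"
      using Psi_eq_imp p by metis
    note SU = S_U2_U1_SU3[OF h(1)]
    have "assoc_class p' = {(g ** (h ** k), adj (h ** k) ** X ** (h ** k)) | k. k \<in> S_U2_U1}"
      by (simp add: p assoc_class_eq h adj_mult matrix_mul_assoc)
    also have "\<dots> = {(g ** k, adj k ** X ** k) | k. k \<in> S_U2_U1}"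
    proof (intro equalityI subsetI; clarify)
      fix k assume "k \<in> S_U2_U1"
      then show "\<exists>k'. (g ** (h ** k), adj (h ** k) ** X ** (h ** k)) = (g ** k', adj k' ** X ** k') \<and> k' \<in> S_U2_U1"
        using S_U2_U1_mult h(1) by blast
      have "h ** (adj h ** k) = k" by (simp add: matrix_mul_assoc SU_right[OF SU])
      then show "\<exists>k'. (g ** k, adj k ** X ** k) = (g ** (h ** k'), adj (h ** k') ** X ** (h ** k')) \<and> k' \<in> S_U2_U1"
        using S_U2_U1_mult[OF S_U2_U1_adj[OF h(1)] \<open>k \<in> S_U2_U1\<close>] by metis
    qed
    finally show "assoc_class p = assoc_class p'" by (simp add: p assoc_class_eq)
  qed
qed

section \<open>Continuity, compactness and the closedness of \<open>Psi\<close>\<close>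

lemma continuous_on_mm [continuous_intros]:
  "continuous_on S f \<Longrightarrow> continuous_on S g \<Longrightarrow> continuous_on S (\<lambda>x. f x ** g x)"
  for f :: "'a::topological_space \<Rightarrow> complex^'n^'m" and g :: "'a \<Rightarrow> complex^'k^'n"
  unfolding matrix_matrix_mult_def by (intro continuous_intros)

lemma continuous_on_adj [continuous_intros]:
  "continuous_on S f \<Longrightarrow> continuous_on S (\<lambda>x. adj (f x))"
  unfolding adj_def conj_mat_def map_matrix_def transpose_def by (simp, intro continuous_intros)

lemma continuous_on_conj_mat [continuous_intros]:
  "continuous_on S f \<Longrightarrow> continuous_on S (\<lambda>x. conj_mat (f x))"
  unfolding conj_mat_def map_matrix_def by (intro continuous_intros)

lemma continuous_on_smul [continuous_intros]:
  "continuous_on S f \<Longrightarrow> continuous_on S g \<Longrightarrow> continuous_on S (\<lambda>x. smul (f x) (g x))"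
  unfolding smul_def by (intro continuous_intros)

lemma continuous_on_trace [continuous_intros]:
  "continuous_on S f \<Longrightarrow> continuous_on S (\<lambda>x. trace (f x))"
  for f :: "'a::topological_space \<Rightarrow> complex^'n^'n"
  unfolding trace_def by (intro continuous_intros)

lemma continuous_on_det [continuous_intros]:
  "continuous_on S f \<Longrightarrow> continuous_on S (\<lambda>x. det (f x))"
  for f :: "'a::topological_space \<Rightarrow> complex^'n^'n"
  unfolding det_def by (intro continuous_intros)

lemma continuous_on_rho [continuous_intros]:
  "continuous_on S f \<Longrightarrow> continuous_on S (\<lambda>x. rho (f x))"
  unfolding rho_def by (intro continuous_intros)

lemma continuous_on_Psi: "continuous_on S Psi"
  unfolding Psi_def cayley_def case_prod_unfold by (intro continuous_intros) auto

lemma closed_SU: "closed (SU :: (complex^'n^'n) set)"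
proof -
  have eq: "SU = {A :: complex^'n^'n. A ** adj A = mat 1} \<inter> {A. det A = 1}"
    by (auto simp: SU_iff)
  show ?thesis
    unfolding eq by (intro closed_Int closed_Collect_eq continuous_intros)
qed

lemma compact_SU: "compact (SU :: (complex^'n^'n) set)"
proof -
  have "bounded (SU :: (complex^'n^'n) set)"
    unfolding bounded_iff
  proof (intro exI ballI)
    fix A :: "complex^'n^'n" assume "A \<in> SU"
    then have "complex_of_real ((norm A)\<^sup>2) = of_real (real CARD('n))"
      using trace_mult_adj[of A] by (simp add: SU_right trace_I)
    then have "(norm A)\<^sup>2 = real CARD('n)" unfolding of_real_eq_iff .
    then show "norm A \<le> sqrt (real CARD('n))" by (simp add: real_le_rsqrt)
  qed
  then show ?thesis using closed_SU compact_eq_bounded_closed by blast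
qed

lemma HH_eq: "HH = SU3 \<inter> {B. Im (trace B) = 0}"
  by (auto simp: HH_def complex_is_Real_iff)

lemma compact_HH: "compact HH"
  unfolding HH_eq by (intro compact_Int_closed compact_SU closed_Collect_eq continuous_intros)

lemma closed_su2: "closed su2"
proof -
  have eq: "su2 = {X. adj X = - X} \<inter> {X. trace X = 0} \<inter> (\<Inter>i. {X. X$i$3 = 0} \<inter> {X. X$3$i = 0})"
    by (auto simp: su2_def adj_def)
  show ?thesis
    unfolding eq by (intro closed_Int closed_INT ballI closed_Collect_eq continuous_intros)
qed

lemma compact_su2_rho: "compact {X \<in> su2. rho X \<le> r}"
proof -
  have "bounded {X \<in> su2. rho X \<le> r}"
    unfolding bounded_iff
  proof (intro exI ballI)
    fix X assume "X \<in> {X \<in> su2. rho X \<le> r}"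
    then show "norm X \<le> sqrt (2 * r - 2)" by (simp add: real_le_rsqrt norm_su2)
  qed
  moreover have "closed {X \<in> su2. rho X \<le> r}"
    unfolding Collect_conj_eq Collect_mem_eq
    by (intro closed_Int closed_su2 closed_Collect_le continuous_intros)
  ultimately show ?thesis using compact_eq_bounded_closed by blast
qed

text \<open>\<open>Psi\<close> is proper away from the identity: a point of the closure has a
  neighbourhood on which the trace bounds \<open>rho\<close>, so only a compact part
  \<open>K\<close> of the closed set matters there, and its image is closed.\<close>

lemma closed_map_Psi: "closed_map (top_of_set (SU3 \<times> su2)) (top_of_set (HH - {mat 1})) Psi"
  unfolding closed_map_def
proof (intro allI impI)
  fix C assume cl: "closedin (top_of_set (SU3 \<times> su2)) C"
  have C: "closed C" "C \<subseteq> SU3 \<times> su2"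
    using closedin_closed_trans[OF cl closed_Times[OF closed_SU closed_su2]] closedin_imp_subset[OF cl] by blast+
  have sub: "Psi ` C \<subseteq> HH - {mat 1}"
    unfolding Psi_image[symmetric] by (rule image_mono[OF C(2)])
  have eq: "Psi ` C = (HH - {mat 1}) \<inter> closure (Psi ` C)"
  proof (intro equalityI subsetI)
    fix B assume B: "B \<in> Psi ` C"
    show "B \<in> (HH - {mat 1}) \<inter> closure (Psi ` C)"
      by (rule IntI[OF subsetD[OF sub B] subsetD[OF closure_subset B]])
  next
    fix B assume B: "B \<in> (HH - {mat 1}) \<inter> closure (Psi ` C)"
    then have "B \<in> Psi ` (SU3 \<times> su2)" by (simp add: Psi_image)
    then obtain g X where gX: "g \<in> SU3" "X \<in> su2" "B = Psi (g, X)" by blast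
    define K where "K = C \<inter> SU3 \<times> {Y \<in> su2. rho Y \<le> 2 * rho X}"
    \<comment> \<open>The threshold is halfway between \<open>3 - 4 / rho X\<close>, the trace of
      \<open>B\<close>, and 3. Below it \<open>rho Y < 2 * rho X\<close>, whence the bound in
      \<open>K\<close>.\<close>
    define V where "V = {D :: complex^3^3. Re (trace D) < 3 - 2 / rho X}"
    have "open V" unfolding V_def by (intro open_Collect_less continuous_intros)
    have "B \<in> V"
      by (simp add: V_def gX trace_Psi divide_simps)
    have "V \<inter> Psi ` C \<subseteq> Psi ` K"
    proof clarify
      fix g' Y assume *: "(g', Y) \<in> C" "Psi (g', Y) \<in> V"
      then have g': "g' \<in> SU3" "Y \<in> su2" using C(2) by auto
      have "2 / rho X < 4 / rho Y"
        using *(2) by (simp add: V_def trace_Psi[OF g'])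
      then have "rho Y \<le> 2 * rho X"
        by (simp add: divide_less_eq less_divide_eq)
      then show "Psi (g', Y) \<in> Psi ` K" using * g' by (auto simp: K_def)
    qed
    moreover have "compact K"
      unfolding K_def by (intro closed_Int_compact C(1) compact_Times compact_SU compact_su2_rho)
    then have "closed (Psi ` K)"
      by (intro compact_imp_closed compact_continuous_image continuous_on_Psi)
    ultimately have "closure (V \<inter> Psi ` C) \<subseteq> Psi ` K" by (rule closure_minimal)
    then have "B \<in> Psi ` K"
      using open_Int_closure_subset[OF \<open>open V\<close>, of "Psi ` C"] \<open>B \<in> V\<close> B by blast
    then show "B \<in> Psi ` C" by (auto simp: K_def)
  qed
  show "closedin (top_of_set (HH - {mat 1})) (Psi ` C)"
    by (subst eq) (rule closedin_closed_Int[OF closed_closure])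
qed

lemma quotient_map_Psi: "quotient_map (top_of_set (SU3 \<times> su2)) (top_of_set (HH - {mat 1})) Psi"
  using closed_map_Psi continuous_on_Psi Psi_image
  by (intro continuous_closed_imp_quotient_map) auto

section \<open>Comparison of quotients and one-point compactifications\<close>

text \<open>The induced map is itself a quotient map, because \<open>h \<circ> q\<close> and
  \<open>q\<close> are, and equal fibres make it injective. No inverse has to be shown continuous by
  hand.\<close>

lemma homeomorphic_map_same_fibres:
  assumes q: "quotient_map X Y q" and f: "quotient_map X Z f"
    and eq: "\<And>x x'. x \<in> topspace X \<Longrightarrow> x' \<in> topspace X \<Longrightarrow> q x = q x' \<longleftrightarrow> f x = f x'"
  obtains h where "homeomorphic_map Y Z h" "\<And>x. x \<in> topspace X \<Longrightarrow> h (q x) = f x"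
proof
  define h where "h y = f (inv_into (topspace X) q y)" for y
  show hq: "h (q x) = f x" if "x \<in> topspace X" for x
    unfolding h_def by (subst eq[symmetric]) (use that in \<open>auto simp: inv_into_into f_inv_into_f\<close>)
  have qX: "q ` topspace X = topspace Y" using q by (simp add: quotient_map_def)
  have hf: "quotient_map X Z (h \<circ> q)"
    by (rule quotient_map_eq[OF f]) (simp add: hq)
  then have "quotient_map Y Z h"
    using q quotient_map_compose_eq by blast
  moreover have "inj_on h (topspace Y)"
    unfolding qX[symmetric] by (auto simp: inj_on_def hq eq)
  ultimately show "homeomorphic_map Y Z h" by (simp add: homeomorphic_map_def)
qed

text \<open>A continuous bijection from a compact space onto a Hausdorff space is a homeomorphism,
  so only continuity is at stake. At the added point it holds because the complement of an open
  neighbourhood of \<open>a\<close> is compact, and \<open>h\<close> pulls compact sets back to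
  compact sets.\<close>

lemma homeomorphic_map_Alexandroff_compactification:
  assumes X: "compact_space X" "Hausdorff_space X" "a \<in> topspace X"
    and h: "homeomorphic_map Y (subtopology X (topspace X - {a})) h"
  shows "homeomorphic_map (Alexandroff_compactification Y) X (case_option a h)"
proof (rule continuous_imp_homeomorphic_map)
  have im: "h ` topspace Y = topspace X - {a}"
    using homeomorphic_imp_surjective_map[OF h] by auto
  have inj: "inj_on h (topspace Y)" using homeomorphic_imp_injective_map[OF h] .
  have cont: "continuous_map Y X h"
    using homeomorphic_imp_continuous_map[OF h] continuous_map_in_subtopology by blast
  show "case_option a h ` topspace (Alexandroff_compactification Y) = topspace X"
    using im X(3) by (auto simp: image_image)
  show "inj_on (case_option a h) (topspace (Alexandroff_compactification Y))"
    using inj im by (auto simp: inj_on_def)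
  show "continuous_map (Alexandroff_compactification Y) X (case_option a h)"
    unfolding continuous_map_def
  proof (intro conjI allI impI)
    show "case_option a h \<in> topspace (Alexandroff_compactification Y) \<rightarrow> topspace X"
      using im X(3) by auto
    fix U assume U: "openin X U"
    define W where "W = {y \<in> topspace Y. h y \<in> U}"
    have W: "openin Y W" unfolding W_def using cont U by (simp add: continuous_map_def)
    show "openin (Alexandroff_compactification Y)
       {x \<in> topspace (Alexandroff_compactification Y). case_option a h x \<in> U}"
    proof (cases "a \<in> U")
      case False
      then have "{x \<in> topspace (Alexandroff_compactification Y). case_option a h x \<in> U} = Some ` W"
        by (auto simp: W_def)
      then show ?thesis using W by simp
    next
      case True
      have "h ` (topspace Y - W) = topspace X - U"
        using im True by (auto simp: W_def)
      moreover have "compactin X (topspace X - U)"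
        using U X(1) closedin_compact_space by blast
      ultimately have "compactin (subtopology X (topspace X - {a})) (h ` (topspace Y - W))"
        using True by (auto simp: compactin_subtopology)
      then have "compactin Y (topspace Y - W)"
        using homeomorphic_map_compactness[OF h] by blast
      moreover have "closedin Y (topspace Y - W)" using W by blast
      moreover have "{x \<in> topspace (Alexandroff_compactification Y). case_option a h x \<in> U} =
          insert None (Some ` (topspace Y - (topspace Y - W)))"
        using True by (auto simp: W_def)
      ultimately show ?thesis
        unfolding openin_Alexandroff_compactification by blast
    qed
  qed
qed (use X in auto)

section \<open>The circle bundle\<close>

text \<open>This is Q as a rational expression in B. The matrix B + B^* is 2 cos(theta) on the plane
  and 2 on the fixed line, so 2 - B - B^* = (2 - 2 cos(theta)) Q, while 3 - tr B = 2 - 2 cos(theta).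
  No frame is involved, which makes continuity in B immediate.\<close>

definition plane_proj :: "complex^3^3 \<Rightarrow> complex^3^3" where
  "plane_proj B = smul (1 / (3 - trace B)) (mat 2 - B - adj B)"

definition circle_act :: "complex^3^3 \<Rightarrow> complex \<Rightarrow> complex^3^3" where
  "circle_act A z = (smul z (plane_proj (Gamma_map A)) + smul ((cnj z)\<^sup>2) (mat 1 - plane_proj (Gamma_map A))) ** A"

text \<open>The matrix of the complex bilinear cross product with \<open>e\<close>.\<close>

definition cross_mat :: "complex^3 \<Rightarrow> complex^3^3" where
  "cross_mat e = vector [vector [0, - e$3, e$2], vector [e$3, 0, - e$1], vector [- e$2, e$1, 0]]"

text \<open>In terms of an orthonormal frame \<open>g\<close> with last column \<open>e\<close> this is \<open>gamma_root g X 1\<close>: the minors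
  of \<open>g\<close> are its conjugated entries, so the skew-symmetric part of \<open>g ** JJ ** transpose g\<close> depends on
  \<open>e\<close> only.\<close>

definition lift_mat :: "complex^3 \<Rightarrow> complex^3^3 \<Rightarrow> complex^3^3" where
  "lift_mat e B = smul (of_real (1 / sqrt (3 - Re (trace B)))) ((mat 1 - B) ** cross_mat (conj_vec e))
     + (\<chi> i j. e$i * e$j)"

text \<open>A fixed unit vector of \<open>B\<close> is determined only up to phase. Projecting the
  constant vector \<open>v\<close> onto the fixed line selects the phase continuously, as long as
  the projection is non-zero.\<close>

definition unit_fixed :: "complex^3 \<Rightarrow> complex^3^3 \<Rightarrow> complex^3" where
  "unit_fixed v B = of_real (1 / norm ((mat 1 - plane_proj B) *v v)) *s ((mat 1 - plane_proj B) *v v)"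

definition local_section :: "complex^3 \<Rightarrow> complex^3^3 \<Rightarrow> complex^3^3" where
  "local_section v B = lift_mat (unit_fixed v B) B"

lemma PP_EE: "PP ** PP = PP" "PP ** EE = 0" "EE ** PP = 0" "EE ** EE = EE" "mat 1 - PP = EE"
  by (simp_all add: mat3_eq_iff mm_nth PP_def EE_def mat_nth)

lemma PP_su2: assumes "X \<in> su2" shows "PP ** X = X" "X ** PP = X" "EE ** X = 0" "X ** EE = 0"
  using assms by (simp_all add: mat3_eq_iff mm_nth PP_def EE_def su2_def)

text \<open>The skew part \<open>X\<close> cancels in \<open>cayley X + adj (cayley X)\<close>, and
  only the multiple of \<open>PP\<close> survives.\<close>

lemma plane_proj_Psi:
  assumes "g \<in> SU3" "X \<in> su2"
  shows "plane_proj (Psi (g, X)) = g ** PP ** adj g"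
proof -
  define a where "a = complex_of_real (2 / rho X)"
  have a: "cnj a = a" "a \<noteq> 0" by (simp_all add: a_def)
  have ca: "cayley X = mat 1 - smul a (PP + X)" by (simp add: cayley_def a_def)
  have PPa: "adj PP = PP" by (simp add: PP_def mat3_eq_iff)
  have "mat 2 - cayley X - adj (cayley X) = smul (2 * a) PP"
    by (simp add: ca adj_diff adj_smul adj_add adj_mat su2_adj assms PPa a(1))
      (simp add: vec_eq_iff mat_def algebra_simps)
  then have "g ** (mat 2 - cayley X - adj (cayley X)) ** adj g = smul (2 * a) (g ** PP ** adj g)"
    by (simp add: smul_mult_left smul_mult_right)
  moreover have "g ** (mat 2 - cayley X - adj (cayley X)) ** adj g = mat 2 - Psi (g, X) - adj (Psi (g, X))"
  proof -
    have "mat 2 = smul 2 (mat 1 :: complex^3^3)" by (simp add: vec_eq_iff mat_def)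
    then have "g ** mat 2 ** adj g = mat 2"
      by (simp add: smul_mult_left smul_mult_right SU_right[OF assms(1)])
    then show ?thesis
      by (simp add: Psi_def adj_mult mm_diff_left mm_diff_right matrix_mul_assoc)
  qed
  moreover have "3 - trace (Psi (g, X)) = 2 * a"
    by (simp add: trace_Psi assms a_def)
  ultimately show ?thesis using a by (simp add: plane_proj_def)
qed

lemma root_block_act:
  assumes "X \<in> su2"
  shows "(smul w PP + smul ((cnj w)\<^sup>2) EE) ** root_block X z = root_block X (z * w)"
  by (simp add: root_block_def matrix_mul_assoc mm_add_left matrix_add_ldistrib smul_mult_left smul_mult_right
      PP_EE PP_su2 assms smul_add) (simp add: vec_eq_iff matrix_matrix_mult_def power_mult_distrib algebra_simps)

text \<open>In any frame the action is multiplication of the parameter \<open>z\<close>; the action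
  laws and the invariance of the fibres are read off from this.\<close>

lemma circle_act_gamma_root:
  assumes "g \<in> SU3" "X \<in> su2" "cmod z = 1"
  shows "circle_act (gamma_root g X z) w = gamma_root g X (z * w)"
proof -
  have "smul w (g ** PP ** adj g) + smul ((cnj w)\<^sup>2) (mat 1 - g ** PP ** adj g)
      = g ** (smul w PP + smul ((cnj w)\<^sup>2) EE) ** adj g"
    by (simp add: PP_EE(5)[symmetric] mm_add_left matrix_add_ldistrib smul_mult_left smul_mult_right
        mm_diff_left mm_diff_right SU_right[OF assms(1)])
  then have "circle_act (gamma_root g X z) w = g ** (smul w PP + smul ((cnj w)\<^sup>2) EE) ** adj g ** (g ** root_block X z ** transpose g)"
    by (simp add: circle_act_def Gamma_gamma_root[OF assms] plane_proj_Psi[OF assms(1,2)]) (simp add: gamma_root_def)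
  also have "\<dots> = g ** ((smul w PP + smul ((cnj w)\<^sup>2) EE) ** root_block X z) ** transpose g"
    by (simp add: matrix_mul_assoc mult_adj_cancel'[OF assms(1)])
  finally show ?thesis by (simp add: root_block_act[OF assms(2)] gamma_root_def)
qed

lemma SU3_diff_LL_cases:
  assumes "A \<in> SU3 - LL"
  obtains g X z where "g \<in> SU3" "X \<in> su2" "cmod z = 1" "A = gamma_root g X z"
proof -
  have "Gamma_map A \<in> Psi ` (SU3 \<times> su2)" "A \<in> SU3"
    using assms unfolding mem_SU3_diff_LL Psi_image by auto
  then obtain g X where "g \<in> SU3" "X \<in> su2" "Gamma_map A = Psi (g, X)" by auto
  then show ?thesis using gamma_root_exists[OF \<open>A \<in> SU3\<close>] that by metis
qed

lemma gamma_root_in: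
  assumes "g \<in> SU3" "X \<in> su2" "cmod z = 1"
  shows "gamma_root g X z \<in> SU3 - LL"
  unfolding mem_SU3_diff_LL using assms by (simp add: gamma_root_SU3 Gamma_gamma_root Psi_in_HH del: Diff_iff)

lemma root_block_one: "root_block X 1 = (smul (of_real (1 / sqrt (rho X))) (PP + X) + EE) ** JJ"
  by (simp add: root_block_def)

lemma lift_mat_Psi:
  assumes g: "g \<in> SU3" "\<And>i. g$i$3 = e$i" and X: "X \<in> su2"
  shows "lift_mat e (Psi (g, X)) = gamma_root g X 1"
proof -
  define r where "r = complex_of_real (1 / sqrt (rho X))"
  \<comment> \<open>The entries on the right are the 2x2 minors of the first two columns of
    \<open>g\<close>, up to sign the conjugated entries of the last column.\<close>
  have 1: "cross_mat (conj_vec e) = g ** (JJ - EE) ** transpose g"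
    using SU3_minors(3,6,9)[OF g(1)]
    by (simp add: cross_mat_def mat3_eq_iff mm_nth JJ_def EE_def g(2)[symmetric] algebra_simps)
  have 2: "(\<chi> i j. e$i * e$j) = g ** EE ** transpose g"
    by (simp add: mat3_eq_iff mm_nth EE_def g(2))
  have 3: "mat 1 - Psi (g, X) = smul (of_real (2 / rho X)) (g ** (PP + X) ** adj g)"
    by (simp add: Psi_def cayley_def mm_diff_left mm_diff_right smul_mult_left smul_mult_right SU_right[OF g(1)])
  have 4: "(PP + X) ** (JJ - EE) = (PP + X) ** JJ"
    by (simp add: mm_diff_right mm_add_left PP_EE PP_su2 X)
  define q where "q = sqrt (rho X)"
  have q: "q > 0" "rho X = q\<^sup>2" by (simp_all add: q_def less_imp_le)
  have EE_JJ: "EE ** JJ = EE" by (simp add: mat3_eq_iff mm_nth EE_def JJ_def)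
  \<comment> \<open>The trace factor contributes \<open>sqrt (rho X) / 2\<close> and
    \<open>mat 1 - B\<close> contributes \<open>2 / rho X\<close>; together they give the factor
    \<open>1 / sqrt (rho X)\<close> of the root.\<close>
  have "3 - Re (trace (Psi (g, X))) = (2 / q)\<^sup>2"
    by (simp add: trace_Psi[OF g(1) X] q(2) power_divide)
  then have "sqrt (3 - Re (trace (Psi (g, X)))) = 2 / q" using q(1) by simp
  then have 5: "1 / sqrt (3 - Re (trace (Psi (g, X)))) * (2 / rho X) = 1 / q"
    using q(1) by (simp add: q(2) power2_eq_square)
  have "lift_mat e (Psi (g, X)) = smul r (g ** (PP + X) ** adj g ** (g ** (JJ - EE) ** transpose g)) + g ** EE ** transpose g"
    unfolding lift_mat_def 1 2 3 r_def q_def[symmetric] 5[symmetric] by (simp add: smul_mult_left)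
  also have "g ** (PP + X) ** adj g ** (g ** (JJ - EE) ** transpose g) = g ** ((PP + X) ** (JJ - EE)) ** transpose g"
    by (simp add: matrix_mul_assoc mult_adj_cancel'[OF g(1)])
  also have "smul r (g ** ((PP + X) ** (JJ - EE)) ** transpose g) + g ** EE ** transpose g = gamma_root g X 1"
    unfolding 4 gamma_root_def root_block_one r_def mm_add_left[of _ EE JJ] EE_JJ
    by (simp add: mm_add_left matrix_add_ldistrib smul_mult_left smul_mult_right)
  finally show ?thesis .
qed

text \<open>\<open>B\<close> fixes the range of \<open>mat 1 - plane_proj B\<close>, so
  \<open>unit_fixed v B\<close> can be the last column of a frame, which identifies the section
  pointwise with a root. Its continuity is a separate matter, settled by the explicit
  formula.\<close>

lemma local_section_frame:
  assumes B: "B \<in> HH - {mat 1}" and v: "(mat 1 - plane_proj B) *v v \<noteq> 0"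
  obtains g X where "g \<in> SU3" "X \<in> su2" "B = Psi (g, X)" "local_section v B = gamma_root g X 1"
proof -
  obtain h Y where h: "h \<in> SU3" "Y \<in> su2" "B = Psi (h, Y)"
    using B unfolding Psi_image[symmetric] by auto
  have E: "mat 1 - plane_proj B = h ** EE ** adj h"
    by (simp add: h(3) plane_proj_Psi[OF h(1,2)] PP_EE(5)[symmetric] mm_diff_left mm_diff_right SU_right[OF h(1)])
  have "B ** (mat 1 - plane_proj B) = h ** (cayley Y ** EE) ** adj h"
    unfolding E by (simp add: h(3) Psi_def matrix_mul_assoc mult_adj_cancel'[OF h(1)])
  also have "cayley Y ** EE = EE"
    by (simp add: cayley_def mm_diff_left smul_mult_left mm_add_left PP_EE PP_su2 h(2)) (simp add: vec_eq_iff)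
  finally have "B ** (mat 1 - plane_proj B) = mat 1 - plane_proj B" by (simp add: E)
  then have fixed: "B *v unit_fixed v B = unit_fixed v B"
    by (simp add: unit_fixed_def vector_scalar_commute matrix_vector_mul_assoc)
  have "herm (unit_fixed v B) (unit_fixed v B) = 1"
    unfolding unit_fixed_def by (rule normalize_vector[OF v])
  then obtain g where g: "g \<in> SU3" "\<And>i. g$i$3 = unit_fixed v B $ i" using SU3_last_column by metis
  then obtain X where X: "X \<in> su2" "B = Psi (g, X)"
    using Psi_surj_frame[OF _ _ g fixed] B by blast
  then have "local_section v B = gamma_root g X 1"
    using lift_mat_Psi[OF g X(1)] by (simp add: local_section_def)
  with g(1) X show ?thesis by (rule that)
qed

lemma HH_trace_nonzero: "B \<in> HH - {mat 1} \<Longrightarrow> 3 - trace B \<noteq> 0"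
  and HH_Re_trace: "B \<in> HH - {mat 1} \<Longrightarrow> 3 - Re (trace B) > 0"
  unfolding Psi_image[symmetric] by (auto simp: trace_Psi)

lemma continuous_on_mv [continuous_intros]:
  "continuous_on S f \<Longrightarrow> continuous_on S g \<Longrightarrow> continuous_on S (\<lambda>x. f x *v g x)"
  for f :: "'a::topological_space \<Rightarrow> complex^'n^'m"
  unfolding matrix_vector_mult_def by (intro continuous_intros)

lemma continuous_on_scale [continuous_intros]:
  "continuous_on S f \<Longrightarrow> continuous_on S g \<Longrightarrow> continuous_on S (\<lambda>x. f x *s g x)"
  for f :: "'a::topological_space \<Rightarrow> complex"
  unfolding vector_scalar_mult_def by (intro continuous_intros)

lemma continuous_on_plane_proj [continuous_intros]:
  assumes "continuous_on S f" "\<And>x. x \<in> S \<Longrightarrow> f x \<in> HH - {mat 1}"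
  shows "continuous_on S (\<lambda>x. plane_proj (f x))"
  unfolding plane_proj_def using assms HH_trace_nonzero by (intro continuous_intros) blast+

lemma continuous_on_cross_mat [continuous_intros]:
  assumes "continuous_on S f"
  shows "continuous_on S (\<lambda>x. cross_mat (f x))"
proof -
  have "continuous_on S (\<lambda>x. \<chi> i j. cross_mat (f x) $ i $ j)"
  proof (intro continuous_on_vec_lambda)
    fix i j :: 3
    show "continuous_on S (\<lambda>x. cross_mat (f x) $ i $ j)"
      using exhaust_3[of i] exhaust_3[of j] assms
      by (auto simp: cross_mat_def continuous_on_minus continuous_on_component)
  qed
  then show ?thesis by simp
qed

lemma continuous_on_conj_vec [continuous_intros]:
  "continuous_on S f \<Longrightarrow> continuous_on S (\<lambda>x. conj_vec (f x))"
  unfolding conj_vec_def by (intro continuous_intros)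

lemma continuous_on_local_section:
  "continuous_on {B \<in> HH - {mat 1}. (mat 1 - plane_proj B) *v v \<noteq> 0} (local_section v)"
proof -
  have "sqrt (3 - Re (trace B)) \<noteq> 0" if "B \<in> HH - {mat 1}" for B
    using HH_Re_trace[OF that] by simp
  then show ?thesis
    unfolding local_section_def lift_mat_def unit_fixed_def
    by (intro continuous_intros) auto
qed

lemma continuous_on_Gamma_map [continuous_intros]:
  "continuous_on S f \<Longrightarrow> continuous_on S (\<lambda>x. Gamma_map (f x))"
  unfolding Gamma_map_def by (intro continuous_intros)

lemma continuous_on_circle_act:
  "continuous_on ((SU3 - LL) \<times> sphere 0 1) (\<lambda>(A, z). circle_act A z)"
proof -
  have "Gamma_map (fst x) \<in> HH - {mat 1}" if "x \<in> (SU3 - LL) \<times> sphere 0 1" for x :: "(complex^3^3) \<times> complex"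
    using that mem_SU3_diff_LL by (metis mem_Times_iff)
  then show ?thesis
    unfolding circle_act_def case_prod_unfold by (intro continuous_intros)
qed

text \<open>A local section \<open>s\<close> and a continuous fibre coordinate \<open>d\<close>
  suffice: the trivialisation sends (u, z) to \<open>act (s u) z\<close>, and its inverse is x
  \<mapsto> (p x, d x). Equivariance is the action law.\<close>

lemma principal_circle_bundleI:
  assumes p: "continuous_map E B p"
    and act: "continuous_map (prod_topology E circle) E (\<lambda>(x, z). act x z)"
      "\<And>x. x \<in> topspace E \<Longrightarrow> act x 1 = x"
      "\<And>x z w. x \<in> topspace E \<Longrightarrow> z \<in> sphere 0 1 \<Longrightarrow> w \<in> sphere 0 1 \<Longrightarrow> act (act x z) w = act x (z * w)"
      "\<And>x z. x \<in> topspace E \<Longrightarrow> z \<in> sphere 0 1 \<Longrightarrow> p (act x z) = p x"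
    and local: "\<And>b. b \<in> topspace B \<Longrightarrow> \<exists>U s d. openin B U \<and> b \<in> U \<and>
      continuous_map (subtopology B U) E s \<and> (\<forall>u\<in>U. p (s u) = u) \<and>
      continuous_map (subtopology E {x \<in> topspace E. p x \<in> U}) circle d \<and>
      (\<forall>x\<in>topspace E. p x \<in> U \<longrightarrow> act (s (p x)) (d x) = x) \<and>
      (\<forall>u\<in>U. \<forall>z\<in>sphere 0 1. d (act (s u) z) = z)"
  shows "principal_circle_bundle E B p"
  unfolding principal_circle_bundle_def
proof (intro conjI exI[of _ act] ballI)
  fix b assume "b \<in> topspace B"
  then obtain U s d where U: "openin B U" "b \<in> U"
    and s: "continuous_map (subtopology B U) E s" "\<And>u. u \<in> U \<Longrightarrow> p (s u) = u"
    and d: "continuous_map (subtopology E {x \<in> topspace E. p x \<in> U}) circle d"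
      "\<And>x. x \<in> topspace E \<Longrightarrow> p x \<in> U \<Longrightarrow> act (s (p x)) (d x) = x"
      "\<And>u z. u \<in> U \<Longrightarrow> z \<in> sphere 0 1 \<Longrightarrow> d (act (s u) z) = z"
    using local[of b] by blast
  define \<phi> where "\<phi> = (\<lambda>(u, z). act (s u) z)"
  let ?EU = "subtopology E {x \<in> topspace E. p x \<in> U}"
  have UB: "U \<subseteq> topspace B" using openin_subset[OF U(1)] .
  have sE: "s u \<in> topspace E" if "u \<in> U" for u
    using continuous_map_funspace[OF s(1)] that UB by auto
  have actE: "act x z \<in> topspace E" if "x \<in> topspace E" "z \<in> sphere 0 1" for x z
    using funcset_mem[OF continuous_map_funspace[OF act(1)], of "(x, z)"] that by simp
  have pact: "p (act (s u) z) = u" if "u \<in> U" "z \<in> sphere 0 1" for u z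
    using act(4)[OF sE] s(2) that by simp
  have cd: "continuous_map (prod_topology (subtopology B U) circle) E \<phi>"
  proof -
    have "continuous_map (prod_topology (subtopology B U) circle) (prod_topology E circle) (\<lambda>x. (s (fst x), snd x))"
      by (intro continuous_map_pairedI continuous_map_compose[OF continuous_map_fst s(1), unfolded o_def]
          continuous_map_snd)
    from continuous_map_compose[OF this act(1)] show ?thesis
      by (simp add: \<phi>_def o_def case_prod_unfold)
  qed
  have "homeomorphic_maps (prod_topology (subtopology B U) circle) ?EU \<phi> (\<lambda>x. (p x, d x))"
    unfolding homeomorphic_maps_def
  proof (intro conjI ballI)
    show "continuous_map (prod_topology (subtopology B U) circle) ?EU \<phi>"
      using cd pact by (auto simp: continuous_map_in_subtopology \<phi>_def sE actE)
    show "continuous_map ?EU (prod_topology (subtopology B U) circle) (\<lambda>x. (p x, d x))"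
      by (intro continuous_map_pairedI d(1))
        (auto simp: continuous_map_in_subtopology continuous_map_from_subtopology[OF p])
  next
    fix x assume "x \<in> topspace (prod_topology (subtopology B U) circle)"
    then show "(p (\<phi> x), d (\<phi> x)) = x" using pact d(3) by (auto simp: \<phi>_def)
  next
    fix x assume "x \<in> topspace ?EU"
    then show "\<phi> (p x, d x) = x" using d(2) by (auto simp: \<phi>_def)
  qed
  then have "homeomorphic_map (prod_topology (subtopology B U) circle) ?EU \<phi>"
    using homeomorphic_map_maps by blast
  moreover have "\<forall>u\<in>U. \<forall>z\<in>sphere 0 1. p (\<phi> (u, z)) = u" using pact by (simp add: \<phi>_def)
  moreover have "\<forall>u\<in>U. \<forall>z\<in>sphere 0 1. \<forall>w\<in>sphere 0 1. \<phi> (u, z * w) = act (\<phi> (u, z)) w"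
    using act(3) sE by (simp add: \<phi>_def)
  ultimately show "\<exists>U \<phi>. openin B U \<and> b \<in> U \<and> homeomorphic_map (prod_topology (subtopology B U) circle)
        (subtopology E {x \<in> topspace E. p x \<in> U}) \<phi> \<and> (\<forall>u\<in>U. \<forall>z\<in>sphere 0 1. p (\<phi> (u, z)) = u) \<and>
      (\<forall>u\<in>U. \<forall>z\<in>sphere 0 1. \<forall>w\<in>sphere 0 1. \<phi> (u, z * w) = act (\<phi> (u, z)) w)"
    using U by blast
qed (use p act in auto)

text \<open>If A is z times the section on the plane, then Q A S^* = z Q for the value S of the
  section; the division by 2 accounts for the rank of Q.\<close>

definition fibre_coord :: "complex^3 \<Rightarrow> complex^3^3 \<Rightarrow> complex" where
  "fibre_coord v A = trace (plane_proj (Gamma_map A) ** A ** adj (local_section v (Gamma_map A))) / 2"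

lemma fibre_coord_gamma_root:
  assumes "g \<in> SU3" "X \<in> su2" "cmod z = 1" "local_section v (Psi (g, X)) = gamma_root g X 1"
  shows "fibre_coord v (gamma_root g X z) = z"
proof -
  have c: "root_block X z ** adj (root_block X 1) = smul z PP + smul ((cnj z)\<^sup>2) EE"
    using root_block_act[OF assms(2), of z 1, symmetric] mult_adj_cancel[OF root_block_SU3(1)[OF assms(2), of 1]] by simp
  have "plane_proj (Psi (g, X)) ** gamma_root g X z ** adj (gamma_root g X 1)
      = g ** PP ** (adj g ** g) ** root_block X z ** (transpose g ** conj_mat g) ** adj (root_block X 1) ** adj g"
    by (simp add: plane_proj_Psi[OF assms(1,2)] gamma_root_def adj_mult adj_transpose matrix_mul_assoc)
  also have "\<dots> = g ** (PP ** (root_block X z ** adj (root_block X 1)) ** adj g)"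
    by (simp add: SU_left[OF assms(1)] SU_transpose_conj[OF assms(1)] matrix_mul_assoc)
  also have "PP ** (root_block X z ** adj (root_block X 1)) = smul z PP"
    by (simp add: c matrix_add_ldistrib smul_mult_right PP_EE) (simp add: vec_eq_iff)
  finally have "trace (plane_proj (Psi (g, X)) ** gamma_root g X z ** adj (gamma_root g X 1)) = trace (smul z PP ** adj g ** g)"
    by (simp only: trace_mul_sym[of g])
  also have "\<dots> = 2 * z"
    by (simp add: mult_adj_cancel'[OF assms(1)]) (simp add: PP_def trace_def sum_3)
  finally show ?thesis
    by (simp add: fibre_coord_def Gamma_gamma_root assms)
qed

text \<open>The base is an arbitrary homeomorphic copy of \<open>HH - {mat 1}\<close>, so that the
  abstract associated bundle can be inserted; all computations take place in \<open>HH\<close>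
  through \<psi>.\<close>

lemma principal_circle_bundle_Gamma:
  assumes hom: "homeomorphic_maps B (top_of_set (HH - {mat 1})) \<psi> \<eta>"
  shows "principal_circle_bundle (top_of_set (SU3 - LL)) B (\<lambda>A. \<eta> (Gamma_map A))"
proof (rule principal_circle_bundleI[where act = circle_act])
  have \<psi>: "continuous_map B (top_of_set (HH - {mat 1})) \<psi>"
    and \<eta>: "continuous_map (top_of_set (HH - {mat 1})) B \<eta>"
    and \<eta>\<psi>: "\<And>b. b \<in> topspace B \<Longrightarrow> \<eta> (\<psi> b) = b"
    and \<psi>\<eta>: "\<And>D. D \<in> HH - {mat 1} \<Longrightarrow> \<psi> (\<eta> D) = D"
    using hom by (auto simp: homeomorphic_maps_def)
  have G: "Gamma_map A \<in> HH - {mat 1}" if "A \<in> SU3 - LL" for A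
    using that mem_SU3_diff_LL by blast
  have Gc: "continuous_map (top_of_set (SU3 - LL)) (top_of_set (HH - {mat 1})) Gamma_map"
    using G by (auto simp: intro!: continuous_intros)
  show "continuous_map (top_of_set (SU3 - LL)) B (\<lambda>A. \<eta> (Gamma_map A))"
    using continuous_map_compose[OF Gc \<eta>] by (simp add: o_def)
  have actin: "circle_act A z \<in> SU3 - LL" "Gamma_map (circle_act A z) = Gamma_map A"
    if "A \<in> SU3 - LL" "z \<in> sphere 0 1" for A z
  proof -
    obtain g X w where "g \<in> SU3" "X \<in> su2" "cmod w = 1" "A = gamma_root g X w"
      using SU3_diff_LL_cases[OF \<open>A \<in> SU3 - LL\<close>] .
    moreover from this have "cmod (w * z) = 1" using that by (simp add: norm_mult)
    ultimately show "circle_act A z \<in> SU3 - LL" "Gamma_map (circle_act A z) = Gamma_map A"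
      by (simp_all only: circle_act_gamma_root gamma_root_in Gamma_gamma_root)
  qed
  have "prod_topology (top_of_set (SU3 - LL)) circle = top_of_set ((SU3 - LL) \<times> sphere 0 1)"
    by (simp add: subtopology_Times flip: euclidean_product_topology)
  then show "continuous_map (prod_topology (top_of_set (SU3 - LL)) circle) (top_of_set (SU3 - LL)) (\<lambda>(x, z). circle_act x z)"
    using continuous_on_circle_act actin(1) by auto
  fix A assume "A \<in> topspace (top_of_set (SU3 - LL))"
  then have A: "A \<in> SU3 - LL" by simp
  then obtain g X y where gX: "g \<in> SU3" "X \<in> su2" "cmod y = 1" "A = gamma_root g X y"
    using SU3_diff_LL_cases by blast
  show "circle_act A 1 = A" by (simp add: gX circle_act_gamma_root)
  show "circle_act (circle_act A z) w = circle_act A (z * w)" if "z \<in> sphere 0 1" "w \<in> sphere 0 1" for z w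
    using that by (simp add: gX circle_act_gamma_root norm_mult mult.assoc)
  show "\<eta> (Gamma_map (circle_act A z)) = \<eta> (Gamma_map A)" if "z \<in> sphere 0 1" for z
    using actin(2)[OF A that] by simp
next
  have \<psi>: "continuous_map B (top_of_set (HH - {mat 1})) \<psi>"
    and \<eta>\<psi>: "\<And>b. b \<in> topspace B \<Longrightarrow> \<eta> (\<psi> b) = b"
    and \<psi>\<eta>: "\<And>D. D \<in> HH - {mat 1} \<Longrightarrow> \<psi> (\<eta> D) = D"
    and \<psi>B: "\<And>b. b \<in> topspace B \<Longrightarrow> \<psi> b \<in> HH - {mat 1}"
    using hom by (auto simp: homeomorphic_maps_def continuous_map_def)
  fix b assume b: "b \<in> topspace B"
  then have "\<psi> b \<in> Psi ` (SU3 \<times> su2)" using \<psi>B Psi_image by blast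
  then obtain g X where gX: "g \<in> SU3" "X \<in> su2" "\<psi> b = Psi (g, X)" by auto
  \<comment> \<open>The last column of \<open>g\<close>, a vector fixed by \<open>\<psi> b\<close>:
    at \<open>b\<close> the projection returns \<open>v\<close> itself, which is non-zero, so the
    open domain of the section contains \<open>b\<close>.\<close>
  define v where "v = g *v axis 3 1"
  define V where "V = {D \<in> HH - {mat 1}. (mat 1 - plane_proj D) *v v \<noteq> 0}"
  define U where "U = {u \<in> topspace B. \<psi> u \<in> V}"
  have "openin (top_of_set (HH - {mat 1})) V"
  proof -
    have "continuous_on (HH - {mat 1}) (\<lambda>D. (mat 1 - plane_proj D) *v v)"
      by (intro continuous_intros) auto
    then have "openin (top_of_set (HH - {mat 1})) ((HH - {mat 1}) \<inter> (\<lambda>D. (mat 1 - plane_proj D) *v v) -` (- {0}))"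
      by (rule continuous_openin_preimage_gen) auto
    moreover have "(HH - {mat 1}) \<inter> (\<lambda>D. (mat 1 - plane_proj D) *v v) -` (- {0}) = V"
      by (auto simp: V_def)
    ultimately show ?thesis by simp
  qed
  then have U: "openin B U" unfolding U_def using \<psi> by (simp add: continuous_map_def)
  have "(mat 1 - plane_proj (\<psi> b)) *v v = g *v axis 3 1"
  proof -
    have "mat 1 - plane_proj (\<psi> b) = g ** EE ** adj g"
      by (simp add: gX(3) plane_proj_Psi[OF gX(1,2)] PP_EE(5)[symmetric] mm_diff_left mm_diff_right SU_right[OF gX(1)])
    then have "(mat 1 - plane_proj (\<psi> b)) *v v = g *v (EE *v axis 3 1)"
      by (simp add: v_def matrix_vector_mul_assoc mult_adj_cancel'[OF gX(1)])
    also have "EE *v axis 3 1 = axis 3 1"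
      by (simp add: vec_eq_iff forall_3 matrix_vector_mult_def sum_3 EE_def axis_def)
    finally show ?thesis .
  qed
  moreover have "g *v axis 3 1 \<noteq> 0"
  proof
    assume "g *v axis 3 1 = 0"
    then have "adj g *v (g *v axis 3 1) = 0" by simp
    then have "(axis 3 1 :: complex^3) = 0" by (simp add: matrix_vector_mul_assoc SU_left[OF gX(1)])
    then show False by (simp add: axis_eq_0_iff)
  qed
  ultimately have bU: "b \<in> U" using b \<psi>B[OF b] by (simp add: U_def V_def)
  have frame: "\<exists>g X. g \<in> SU3 \<and> X \<in> su2 \<and> D = Psi (g, X) \<and> local_section v D = gamma_root g X 1" if "D \<in> V" for D
    using that local_section_frame unfolding V_def by blast
  have sec: "local_section v D \<in> SU3 - LL" "Gamma_map (local_section v D) = D" if D: "D \<in> V" for D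
  proof -
    obtain g X where *: "g \<in> SU3" "X \<in> su2" "D = Psi (g, X)" "local_section v D = gamma_root g X 1"
      using frame[OF D] by metis
    show "local_section v D \<in> SU3 - LL" "Gamma_map (local_section v D) = D"
      using gamma_root_in[of g X 1] Gamma_gamma_root[of g X 1] * by simp_all
  qed
  have coord: "cmod (fibre_coord v A) = 1" "circle_act (local_section v (Gamma_map A)) (fibre_coord v A) = A"
    if A: "A \<in> SU3 - LL" "Gamma_map A \<in> V" for A
  proof -
    obtain g X where *: "g \<in> SU3" "X \<in> su2" "Gamma_map A = Psi (g, X)" "local_section v (Psi (g, X)) = gamma_root g X 1"
      using frame[OF A(2)] by metis
    then obtain z where z: "cmod z = 1" "A = gamma_root g X z" using gamma_root_exists A(1) by blast
    have "fibre_coord v A = z" using fibre_coord_gamma_root * z by simp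
    then show "cmod (fibre_coord v A) = 1" "circle_act (local_section v (Gamma_map A)) (fibre_coord v A) = A"
      using * z by (simp_all add: circle_act_gamma_root)
  qed
  have coord_act: "fibre_coord v (circle_act (local_section v D) z) = z" if D: "D \<in> V" "cmod z = 1" for D z
  proof -
    obtain g X where *: "g \<in> SU3" "X \<in> su2" "D = Psi (g, X)" "local_section v (Psi (g, X)) = gamma_root g X 1"
      using frame[OF D(1)] by metis
    then show ?thesis by (simp add: circle_act_gamma_root fibre_coord_gamma_root D)
  qed
  have pU: "{A \<in> SU3 - LL. \<eta> (Gamma_map A) \<in> U} = {A \<in> SU3 - LL. Gamma_map A \<in> V}"
  proof -
    have "\<eta> (Gamma_map A) \<in> U \<longleftrightarrow> Gamma_map A \<in> V" if "A \<in> SU3 - LL" for A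
    proof -
      have "Gamma_map A \<in> HH - {mat 1}" using that mem_SU3_diff_LL by blast
      moreover from this have "\<eta> (Gamma_map A) \<in> topspace B"
        using hom by (auto simp: homeomorphic_maps_def continuous_map_def)
      ultimately show ?thesis using \<psi>\<eta> by (simp add: U_def)
    qed
    then show ?thesis by blast
  qed
  have f1: "continuous_map (subtopology B U) (top_of_set (SU3 - LL)) (local_section v \<circ> \<psi>)"
  proof (rule continuous_map_compose)
    show "continuous_map (subtopology B U) (top_of_set V) \<psi>"
      using \<psi> by (auto simp: continuous_map_in_subtopology U_def continuous_map_from_subtopology)
    show "continuous_map (top_of_set V) (top_of_set (SU3 - LL)) (local_section v)"
      using continuous_on_local_section[of v, folded V_def] sec(1) by auto
  qed
  have f2: "continuous_map (top_of_set {A \<in> SU3 - LL. Gamma_map A \<in> V}) circle (fibre_coord v)"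
  proof -
    have "continuous_on {A \<in> SU3 - LL. Gamma_map A \<in> V} (\<lambda>A. local_section v (Gamma_map A))"
      by (rule continuous_on_compose2[OF continuous_on_local_section[of v, folded V_def]])
        (auto intro!: continuous_intros)
    then have "continuous_on {A \<in> SU3 - LL. Gamma_map A \<in> V} (fibre_coord v)"
      unfolding fibre_coord_def by (intro continuous_intros) (auto simp: V_def)
    then show ?thesis using coord(1) by auto
  qed
  have f3: "subtopology (top_of_set (SU3 - LL)) {x \<in> topspace (top_of_set (SU3 - LL)). \<eta> (Gamma_map x) \<in> U}
      = top_of_set {A \<in> SU3 - LL. Gamma_map A \<in> V}"
    unfolding topspace_euclidean_subtopology pU subtopology_subtopology by (rule arg_cong[of _ _ top_of_set]) auto
  have f4: "\<forall>u\<in>U. \<eta> (Gamma_map ((local_section v \<circ> \<psi>) u)) = u"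
    using sec(2) \<eta>\<psi> by (simp add: U_def)
  have f5: "\<forall>A\<in>topspace (top_of_set (SU3 - LL)). \<eta> (Gamma_map A) \<in> U \<longrightarrow>
      circle_act ((local_section v \<circ> \<psi>) (\<eta> (Gamma_map A))) (fibre_coord v A) = A"
  proof (intro ballI impI)
    fix A assume "A \<in> topspace (top_of_set (SU3 - LL))" "\<eta> (Gamma_map A) \<in> U"
    then have A: "A \<in> SU3 - LL" "Gamma_map A \<in> V" using pU by auto
    then have "\<psi> (\<eta> (Gamma_map A)) = Gamma_map A" using \<psi>\<eta> by (simp add: V_def)
    then show "circle_act ((local_section v \<circ> \<psi>) (\<eta> (Gamma_map A))) (fibre_coord v A) = A"
      using coord(2)[OF A] by simp
  qed
  have f6: "\<forall>u\<in>U. \<forall>z\<in>sphere 0 1. fibre_coord v (circle_act ((local_section v \<circ> \<psi>) u) z) = z"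
    using coord_act by (simp add: U_def)
  show "\<exists>U s d. openin B U \<and> b \<in> U \<and> continuous_map (subtopology B U) (top_of_set (SU3 - LL)) s \<and>
      (\<forall>u\<in>U. \<eta> (Gamma_map (s u)) = u) \<and>
      continuous_map (subtopology (top_of_set (SU3 - LL)) {x \<in> topspace (top_of_set (SU3 - LL)). \<eta> (Gamma_map x) \<in> U}) circle d \<and>
      (\<forall>x\<in>topspace (top_of_set (SU3 - LL)). \<eta> (Gamma_map x) \<in> U \<longrightarrow> circle_act (s (\<eta> (Gamma_map x))) (d x) = x) \<and>
      (\<forall>u\<in>U. \<forall>z\<in>sphere 0 1. d (circle_act (s u) z) = z)"
    by (intro exI[of _ U] exI[of _ "local_section v \<circ> \<psi>"] exI[of _ "fibre_coord v"] conjI)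
      (rule U bU f1 f4 f5 f6 f2[folded f3])+
qed

section \<open>Smoothness of the hypersurface\<close>

lemma C_k_on_const: "C_k_on k (\<lambda>x. c) U"
proof (induction k arbitrary: c)
  case (Suc k)
  have "\<forall>x\<in>U. ((\<lambda>x. c) has_derivative (\<lambda>v. 0)) (at x)" by simp
  then show ?case using Suc[of 0] unfolding C_k_on.simps by (intro exI[of _ "\<lambda>x v. 0"] conjI allI)
qed simp

lemma smooth_on_bounded_linear:
  assumes "bounded_linear f"
  shows "smooth_on f U"
  unfolding smooth_on_def
proof
  fix k show "C_k_on k f U"
  proof (cases k)
    case 0
    then show ?thesis using assms by (simp add: linear_continuous_on)
  next
    case (Suc n)
    have "\<forall>x\<in>U. (f has_derivative f) (at x)" using assms bounded_linear_imp_has_derivative by blast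
    then show ?thesis unfolding Suc C_k_on.simps by (intro exI[of _ "\<lambda>x. f"] conjI allI C_k_on_const)
  qed
qed

text \<open>The circle diag(z, z, z^{-2}) of the bundle action, run at unit speed. Conjugated by a
  frame, it yields the direction in SU(3) transverse to the hypersurface.\<close>

definition torus_curve :: "real \<Rightarrow> complex^3^3" where
  "torus_curve t = smul (cis t) PP + smul (cis (- 2 * t)) EE"

lemma torus_curve_SU3: "torus_curve t \<in> SU3"
proof -
  have "det (torus_curve t) = cis (t + t + - 2 * t)"
    by (simp only: cis_mult[symmetric]) (simp add: torus_curve_def PP_def EE_def det_3)
  moreover have "torus_curve t ** adj (torus_curve t) = mat 1"
    by (simp add: torus_curve_def mat3_eq_iff mm_nth mat_nth PP_def EE_def cis_cnj cis_mult)
  ultimately show ?thesis by (simp add: SU_iff)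
qed

lemma scaleR_eq_smul: "r *\<^sub>R A = smul (of_real r) A"
  by (simp add: vec_eq_iff vector_scaleR_component) (simp add: scaleR_conv_of_real)

lemma bounded_linear_mm: "bounded_linear (\<lambda>A. B ** A ** C)"
  for B :: "complex^'n^'m" and C :: "complex^'l^'k"
  by (rule linear_conv_bounded_linear[THEN iffD1], rule linearI)
    (simp_all add: matrix_add_ldistrib mm_add_left scaleR_eq_smul smul_mult_left smul_mult_right)

lemma torus_curve_deriv:
  "(torus_curve has_vector_derivative smul \<i> PP + smul (- 2 * \<i>) EE) (at 0)"
proof -
  have cis: "((\<lambda>t. cis (a * t)) has_vector_derivative of_real a * \<i>) (at 0)" for a
    unfolding has_vector_derivative_def
    by (auto intro!: derivative_eq_intros simp: scaleR_conv_of_real algebra_simps)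
  have lin: "bounded_linear (\<lambda>z. smul z A)" for A :: "complex^3^3"
    by (rule linear_conv_bounded_linear[THEN iffD1], rule linearI)
      (simp_all add: vec_eq_iff algebra_simps)
  show ?thesis
    unfolding torus_curve_def[abs_def]
    using has_vector_derivative_add[OF bounded_linear.has_vector_derivative[OF lin cis[of 1]]
        bounded_linear.has_vector_derivative[OF lin cis[of "-2"]]] by simp
qed

text \<open>The linear function Im tr defines \<open>HH\<close> globally, and its derivative along
  the conjugated torus curve is \<open>- 4 / rho X\<close>. At the identity the tangent vectors are
  traceless, so this function has no transverse direction there.\<close>

lemma HH_hypersurface: "hypersurface_with_singularities SU3 HH {mat 1}"
  unfolding hypersurface_with_singularities_def
proof (intro conjI ballI)
  show "closedin (top_of_set SU3) HH"
    using compact_HH by (intro closed_subset compact_imp_closed) (auto simp: HH_eq)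
  fix B assume "B \<in> HH - {mat 1}"
  then obtain g X where gX: "g \<in> SU3" "X \<in> su2" "B = Psi (g, X)"
    unfolding Psi_image[symmetric] by auto
  define f where "f A = Im (trace A)" for A :: "complex^3^3"
  have lin: "bounded_linear f"
    by (rule linear_conv_bounded_linear[THEN iffD1])
      (auto intro!: linearI simp: f_def trace_def sum_3 algebra_simps)
  define Z where "Z = smul \<i> PP + smul (- 2 * \<i>) EE"
  let ?v = "(g ** cayley X) ** Z ** adj g"
  have curve: "((\<lambda>t. (g ** cayley X) ** torus_curve t ** adj g) has_vector_derivative ?v) (at 0)"
    unfolding Z_def by (rule bounded_linear.has_vector_derivative[OF bounded_linear_mm torus_curve_deriv])
  have "?v \<in> tangent_vectors SU3 B"
    unfolding tangent_vectors_def mem_Collect_eq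
  proof (intro exI[of _ "\<lambda>t. g ** cayley X ** torus_curve t ** adj g"] conjI allI curve)
    show "g ** cayley X ** torus_curve t ** adj g \<in> SU3" for t
      by (intro SU_mult SU_adj torus_curve_SU3 cayley_SU3 gX)
    have "torus_curve 0 = mat 1" by (simp add: torus_curve_def mat3_eq_iff mat_nth PP_def EE_def)
    then show "g ** cayley X ** torus_curve 0 ** adj g = B" by (simp add: gX Psi_def)
  qed
  moreover have "frechet_derivative f (at B) ?v \<noteq> 0"
  proof -
    have "frechet_derivative f (at B) = f"
      using frechet_derivative_at[OF bounded_linear_imp_has_derivative[OF lin]] by simp
    moreover have "trace ?v = trace (cayley X ** Z)"
    proof -
      have "trace ?v = trace (g ** (cayley X ** Z ** adj g))" by (simp add: matrix_mul_assoc)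
      also have "\<dots> = trace (cayley X ** Z)"
        by (simp only: trace_mul_sym[of g] mult_adj_cancel'[OF gX(1)])
      finally show ?thesis .
    qed
    moreover have "trace (cayley X ** Z) = - 4 * \<i> / of_real (rho X)"
    proof -
      \<comment> \<open>\<open>PP + X\<close> annihilates the last coordinate and \<open>Z\<close>
        is \<i> on the plane, so the correction to \<open>Z\<close> is a multiple of
        \<open>PP + X\<close>. With \<open>Z\<close> and \<open>X\<close> traceless, only the trace
        2 of \<open>PP\<close> is left.\<close>
      have "cayley X ** Z = Z - smul (of_real (2 / rho X) * \<i>) (PP + X)"
        by (simp add: Z_def cayley_def mm_diff_left mm_add_left matrix_add_ldistrib smul_mult_left smul_mult_right PP_EE
            PP_su2[OF gX(2)] smul_add) (simp add: vec_eq_iff algebra_simps)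
      moreover have "trace X = 0" using gX(2) by (simp add: su2_def)
      moreover have "trace (Z - smul c (PP + X)) = trace Z - c * (2 + trace X)" for c
        by (simp add: trace_def sum_3 PP_def algebra_simps)
      moreover have "trace Z = 0" by (simp add: Z_def trace_def sum_3 PP_def EE_def)
      ultimately show ?thesis by simp
    qed
    moreover have "Im (- 4 * \<i> / of_real (rho X)) = - 4 / rho X" by simp
    ultimately have "frechet_derivative f (at B) ?v = - 4 / rho X" by (simp add: f_def)
    then show ?thesis by simp
  qed
  ultimately show "smooth_hypersurface_at SU3 HH B"
    unfolding smooth_hypersurface_at_def
    by (intro exI[of _ UNIV] exI[of _ f] conjI bexI[of _ ?v] smooth_on_bounded_linear lin)
      (auto simp: HH_eq f_def)
qed

text \<open>One homeomorphism \<psi>, induced by the common fibres of \<open>assoc_class\<close> and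
  \<open>Psi\<close>, does both jobs: extended by \<open>None\<close> \<mapsto> \<open>mat 1\<close>
  it gives the Thom space, and its inverse after \<open>Gamma_map\<close> is the bundle projection,
  so the two identifications are compatible.\<close>

theorem theorem5p2:
  shows "Gamma_map ` SU3 = HH
    \<and> hypersurface_with_singularities SU3 HH {mat 1}
    \<and> (\<exists>\<Phi> p.
          homeomorphic_map (Alexandroff_compactification Lambda2_minus_CP2) (top_of_set HH) \<Phi>
        \<and> \<Phi> None = mat 1
        \<and> principal_circle_bundle (top_of_set (SU3 - LL)) Lambda2_minus_CP2 p
        \<and> (\<forall>A \<in> SU3 - LL. Gamma_map A = \<Phi> (Some (p A))))"
proof -
  have "quotient_map (top_of_set (SU3 \<times> su2)) Lambda2_minus_CP2 assoc_class"
    unfolding Lambda2_minus_CP2_def by (rule quotient_map_quotient_topology)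
  then obtain \<psi> where \<psi>: "homeomorphic_map Lambda2_minus_CP2 (top_of_set (HH - {mat 1})) \<psi>"
    using homeomorphic_map_same_fibres[OF _ quotient_map_Psi, of _ assoc_class] assoc_class_eq_iff by (metis topspace_euclidean_subtopology)
  then obtain \<eta> where \<eta>: "homeomorphic_maps Lambda2_minus_CP2 (top_of_set (HH - {mat 1})) \<psi> \<eta>"
    using homeomorphic_map_maps by blast
  have "homeomorphic_map (Alexandroff_compactification Lambda2_minus_CP2) (top_of_set HH) (case_option (mat 1) \<psi>)"
  proof (rule homeomorphic_map_Alexandroff_compactification)
    show "compact_space (top_of_set HH)" using compact_HH by (simp add: compact_space_subtopology)
    show "Hausdorff_space (top_of_set HH)" by (simp add: Hausdorff_space_subtopology)
    show "mat 1 \<in> topspace (top_of_set HH)"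
      by (simp add: HH_eq SU_one trace_def sum_3 mat_nth)
    show "homeomorphic_map Lambda2_minus_CP2
      (subtopology (top_of_set HH) (topspace (top_of_set HH) - {mat 1})) \<psi>"
      using \<psi> by (simp add: subtopology_subtopology Int_absorb1)
  qed
  moreover have "\<forall>A \<in> SU3 - LL. Gamma_map A = \<psi> (\<eta> (Gamma_map A))"
    using \<eta> mem_SU3_diff_LL by (auto simp: homeomorphic_maps_def)
  ultimately show ?thesis
    using Gamma_map_image HH_hypersurface principal_circle_bundle_Gamma[OF \<eta>]
    by (intro conjI exI[of _ "case_option (mat 1) \<psi>"] exI[of _ "\<lambda>A. \<eta> (Gamma_map A)"]) simp_all
qed

end
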